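(* The functional $$J(u)=\int_{\mathbb{D}} \frac{e^{4\pi u^2}-1}{(1-|x|^2)^2}\,dx$$ lacks weak continuity at any point in $H_0^1(\mathbb{D})$; that is, for every $u\in H_0^1(\mathbb{D})$ there is a sequence $(u_k)$ in $H_0^1(\mathbb{D})$ with $u_k\rightharpoonup u$ weakly in $H_0^1(\mathbb{D})$ such that $J(u_k)$ does not converge to $J(u)$.
   Context: $\mathbb{D}$ is the open unit disk in $\mathbb{R}^2$, and $H_0^1(\mathbb{D})$ is the usual Sobolev space with norm $\|\nabla u\|_2$. *)

theory Defs
  imports "HOL-Analysis.Analysis"
begin

text \<open>
  Elements of function spaces over a domain \<open>U\<close> are represented by functions on the whole
  space; only their values on \<open>U\<close>, up to null sets, matter.
\<close>

definition partial_deriv :: "'a::euclidean_space \<Rightarrow> ('a \<Rightarrow> real) \<Rightarrow> 'a \<Rightarrow> real" where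
  "partial_deriv b f x = frechet_derivative f (at x) b"

definition grad :: "('a::euclidean_space \<Rightarrow> real) \<Rightarrow> 'a \<Rightarrow> 'a" where
  "grad f x = (\<Sum>b\<in>Basis. partial_deriv b f x *\<^sub>R b)"

primrec C_k :: "nat \<Rightarrow> ('a::euclidean_space \<Rightarrow> real) \<Rightarrow> bool" where
  "C_k 0 f \<longleftrightarrow> continuous_on UNIV f"
| "C_k (Suc n) f \<longleftrightarrow> (\<forall>x. f differentiable (at x)) \<and> (\<forall>b\<in>Basis. C_k n (partial_deriv b f))"

definition test_functions :: "'a::euclidean_space set \<Rightarrow> ('a \<Rightarrow> real) set" where
  "test_functions U =
     {\<phi>. (\<forall>n. C_k n \<phi>) \<and> compact (closure {x. \<phi> x \<noteq> 0}) \<and> closure {x. \<phi> x \<noteq> 0} \<subseteq> U}"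

definition L2 :: "'a::euclidean_space set \<Rightarrow> ('a \<Rightarrow> 'b::euclidean_space) set" where
  "L2 U = {f. f \<in> borel_measurable (lebesgue_on U) \<and>
              integrable (lebesgue_on U) (\<lambda>x. (norm (f x))\<^sup>2)}"

definition L2_norm :: "'a::euclidean_space set \<Rightarrow> ('a \<Rightarrow> 'b::euclidean_space) \<Rightarrow> real" where
  "L2_norm U f = sqrt (\<integral>x. (norm (f x))\<^sup>2 \<partial>lebesgue_on U)"

definition has_weak_grad ::
    "'a::euclidean_space set \<Rightarrow> ('a \<Rightarrow> real) \<Rightarrow> ('a \<Rightarrow> 'a) \<Rightarrow> bool" where
  "has_weak_grad U u g \<longleftrightarrow>
     (\<forall>\<phi>\<in>test_functions U. \<forall>b\<in>Basis.
        (\<integral>x. u x * partial_deriv b \<phi> x \<partial>lebesgue_on U) = - (\<integral>x. (g x \<bullet> b) * \<phi> x \<partial>lebesgue_on U))"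

definition H1 :: "'a::euclidean_space set \<Rightarrow> ('a \<Rightarrow> real) set" where
  "H1 U = {u \<in> L2 U. \<exists>g\<in>L2 U. has_weak_grad U u g}"

text \<open>For \<open>u \<in> H1 U\<close> with \<open>U\<close> open, the choice below is unique up to a null set.\<close>

definition weak_grad :: "'a::euclidean_space set \<Rightarrow> ('a \<Rightarrow> real) \<Rightarrow> 'a \<Rightarrow> 'a" where
  "weak_grad U u = (SOME g. g \<in> L2 U \<and> has_weak_grad U u g)"

text \<open>The closure of the test functions in \<open>H1 U\<close>.\<close>

definition H01 :: "'a::euclidean_space set \<Rightarrow> ('a \<Rightarrow> real) set" where
  "H01 U = {u \<in> H1 U. \<exists>\<phi>::nat \<Rightarrow> 'a \<Rightarrow> real.
     (\<forall>k. \<phi> k \<in> test_functions U) \<and>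
     (\<lambda>k. L2_norm U (\<lambda>x. \<phi> k x - u x)) \<longlonglongrightarrow> 0 \<and>
     (\<lambda>k. L2_norm U (\<lambda>x. grad (\<phi> k) x - weak_grad U u x)) \<longlonglongrightarrow> 0}"

definition H01_norm :: "'a::euclidean_space set \<Rightarrow> ('a \<Rightarrow> real) \<Rightarrow> real" where
  "H01_norm U u = L2_norm U (weak_grad U u)"

text \<open>
  Bounded linear functionals on \<open>H01 U\<close>. Boundedness forces such a functional to agree on
  functions that are equal almost everywhere on \<open>U\<close>.
\<close>

definition H01_dual :: "'a::euclidean_space set \<Rightarrow> (('a \<Rightarrow> real) \<Rightarrow> real) set" where
  "H01_dual U = {L.
     (\<forall>u\<in>H01 U. \<forall>v\<in>H01 U. L (\<lambda>x. u x + v x) = L u + L v) \<and>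
     (\<forall>c. \<forall>u\<in>H01 U. L (\<lambda>x. c * u x) = c * L u) \<and>
     (\<exists>C. \<forall>u\<in>H01 U. \<bar>L u\<bar> \<le> C * H01_norm U u)}"

definition weakly_converges_H01 ::
    "'a::euclidean_space set \<Rightarrow> (nat \<Rightarrow> 'a \<Rightarrow> real) \<Rightarrow> ('a \<Rightarrow> real) \<Rightarrow> bool" where
  "weakly_converges_H01 U us u \<longleftrightarrow> (\<forall>L\<in>H01_dual U. (\<lambda>k. L (us k)) \<longlonglongrightarrow> L u)"

definition unit_disk :: "(real^2) set" where
  "unit_disk = ball 0 1"

text \<open>The integrand is nonnegative, so the integral is taken in \<open>[0, \<infinity>]\<close>.\<close>

definition J :: "(real^2 \<Rightarrow> real) \<Rightarrow> ennreal" where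
  "J u = (\<integral>\<^sup>+x. ennreal ((exp (4 * pi * (u x)\<^sup>2) - 1) / (1 - (norm x)\<^sup>2)\<^sup>2) \<partial>lebesgue_on unit_disk)"

end

theory Submission
  imports Defs
begin

text \<open>
  Near the boundary the weight compensates the area of small disks: a bump of fixed shape, living
  in a disk whose radius is comparable to its distance to the boundary, has bounded energy
  while its contribution to \<open>J\<close> stays above a prescribed constant. Bumps \<open>v k\<close> with disjoint supports
  are orthogonal in \<open>H01\<close>, hence converge weakly to \<open>0\<close>, and convexity of the exponential gives
  \<open>J (u + v k) + J (u - v k) \<ge> 2 J (v k)\<close>. So \<open>J (u + v k)\<close> and \<open>J (u - v k)\<close> cannot both tend to
  \<open>J u\<close>, provided that \<open>J u\<close> is finite.

  Finiteness is a Trudinger inequality for the hyperbolic measure \<open>dx / (1 - |x|\<^sup>2)\<^sup>2\<close>. The field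
  \<open>x / (1 - |x|\<^sup>2)\<close> gives an \<open>L1\<close> Hardy inequality, and with Gagliardo-Nirenberg it bounds the measure of
  \<open>{w\<^sup>2 \<ge> b\<^sup>2}\<close> by the measure of \<open>{w\<^sup>2 \<ge> a\<^sup>2}\<close> times the energy of \<open>w\<close> in between. Chaining \<open>n\<^sup>2\<close> levels of
  width \<open>1 / n\<close> and using the arithmetic-geometric mean inequality, \<open>{|w| \<ge> n}\<close> has measure at most
  \<open>(C \<integral>|\<nabla>w|\<^sup>2)\<close> to the power \<open>n\<^sup>2\<close>. A general \<open>u\<close> is a test function plus a remainder of small
  energy.
\<close>

subsection \<open>Smooth bump functions\<close>

text \<open>\<open>J u\<close> has to be finite for every \<open>u\<close>, of whatever energy,
  while the Trudinger bound is available only below a threshold. Splitting off a bounded test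
  function doubles the exponent from \<open>4 * pi\<close> to \<open>8 * pi\<close>; this merely
  lowers the threshold, since no sharp constant is sought. The decay of the level sets must be
  Gaussian to beat exp(\<alpha> s^2), and this dictates the number of levels. Levels of width 1/n
  cost a factor of order n^2 each, and the mean of the n^2 shell energies is at most E/n^2; the two
  powers cancel and leave (C E)^(n^2). A chain of n unit levels would give only (C E/n)^n, which is
  too weak. The weight has infinite mass near the unit circle, so small values of \<open>u\<close>
  cannot be dismissed: wherever exp is estimated, the subtracted 1 has to be kept, and what remains
  is quadratic and falls to the Hardy inequality. Perturbing with both signs is what permits an
  arbitrary \<open>u\<close>: the cross term u * v k has no known sign, and adding the two cases
  removes it. The bumps are scaled only after \<open>J u\<close> is known, so that 2 J (v k) exceeds
  2 J u by a fixed amount.\<close>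

lemma GDERIV_grad:
  assumes "f differentiable (at x)"
  shows "GDERIV f x :> grad f x"
proof -
  have d: "(f has_derivative frechet_derivative f (at x)) (at x)"
    using assms frechet_derivative_works by blast
  then interpret bounded_linear "frechet_derivative f (at x)" by (rule has_derivative_bounded_linear)
  have "frechet_derivative f (at x) h = h \<bullet> grad f x" for h
  proof -
    have "frechet_derivative f (at x) h = frechet_derivative f (at x) (\<Sum>b\<in>Basis. (h \<bullet> b) *\<^sub>R b)"
      by (simp add: euclidean_representation)
    also have "\<dots> = h \<bullet> grad f x"
      by (simp add: sum scaleR grad_def partial_deriv_def inner_sum_right mult.commute)
    finally show ?thesis .
  qed
  then have "frechet_derivative f (at x) = (\<lambda>h. h \<bullet> grad f x)" by auto
  with d show ?thesis by (simp add: gderiv_def)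
qed

lemma partial_deriv_eqI:
  assumes "GDERIV f x :> g"
  shows "partial_deriv b f x = g \<bullet> b"
  using assms frechet_derivative_at[of f "\<lambda>h. h \<bullet> g" x]
  by (metis gderiv_def inner_commute partial_deriv_def)

lemma grad_eqI:
  assumes "GDERIV f x :> g"
  shows "grad f x = g"
  by (simp add: grad_def partial_deriv_eqI[OF assms] euclidean_representation)

lemma differentiable_GDERIV: "GDERIV f x :> g \<Longrightarrow> f differentiable (at x)"
  by (auto simp: gderiv_def differentiable_def)

lemma partial_deriv_grad:
  assumes "f differentiable (at x)"
  shows "partial_deriv b f x = grad f x \<bullet> b"
  using partial_deriv_eqI[OF GDERIV_grad[OF assms]] .

section \<open>Closure properties of the classes \<open>C_k\<close>\<close>

lemma C_k_SucI:
  assumes "\<And>x. GDERIV f x :> G x" "\<And>b. b \<in> Basis \<Longrightarrow> C_k n (\<lambda>x. G x \<bullet> b)"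
  shows "C_k (Suc n) f"
proof -
  have "partial_deriv b f = (\<lambda>x. G x \<bullet> b)" for b
    using assms(1) partial_deriv_eqI by blast
  with assms show ?thesis by (auto intro: differentiable_GDERIV)
qed

lemma C_k_SucD:
  assumes "C_k (Suc n) f"
  shows "GDERIV f x :> grad f x" "b \<in> Basis \<Longrightarrow> C_k n (\<lambda>x. grad f x \<bullet> b)"
proof -
  show "GDERIV f x :> grad f x" using assms by (auto intro: GDERIV_grad)
  assume "b \<in> Basis"
  moreover have "partial_deriv b f = (\<lambda>x. grad f x \<bullet> b)"
    using assms by (auto intro: partial_deriv_grad)
  ultimately show "C_k n (\<lambda>x. grad f x \<bullet> b)" using assms by auto
qed

lemma C_k_lower: "C_k (Suc n) f \<Longrightarrow> C_k n f"
proof (induction n arbitrary: f)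
  case 0
  then show ?case
    by (auto intro!: continuous_at_imp_continuous_on differentiable_imp_continuous_within)
qed auto

lemma C_k_const: "C_k n (\<lambda>x. c)"
proof (induction n arbitrary: c)
  case (Suc n)
  then show ?case by (intro C_k_SucI[where G="\<lambda>_. 0"] GDERIV_const) auto
qed auto

lemma C_k_add: "C_k n f \<Longrightarrow> C_k n g \<Longrightarrow> C_k n (\<lambda>x. f x + g x)"
proof (induction n arbitrary: f g)
  case (Suc n)
  show ?case
    by (rule C_k_SucI[OF GDERIV_add[OF C_k_SucD(1)[OF Suc.prems(1)] C_k_SucD(1)[OF Suc.prems(2)]]])
      (simp add: inner_add_left Suc.IH C_k_SucD(2)[OF Suc.prems(1)] C_k_SucD(2)[OF Suc.prems(2)])
qed (auto intro: continuous_intros)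

lemma C_k_mult: "C_k n f \<Longrightarrow> C_k n g \<Longrightarrow> C_k n (\<lambda>x. f x * g x)"
proof (induction n arbitrary: f g)
  case (Suc n)
  show ?case
    by (rule C_k_SucI[OF GDERIV_mult[OF C_k_SucD(1)[OF Suc.prems(1)] C_k_SucD(1)[OF Suc.prems(2)]]])
      (simp add: inner_add_left C_k_add Suc.IH C_k_lower[OF Suc.prems(1)] C_k_lower[OF Suc.prems(2)]
        C_k_SucD(2)[OF Suc.prems(1)] C_k_SucD(2)[OF Suc.prems(2)])
qed (auto intro: continuous_intros)

lemma C_k_affine: "C_k n (\<lambda>x. x \<bullet> a + d)"
proof (cases n)
  case (Suc m)
  have "GDERIV (\<lambda>x. x \<bullet> a + d) x :> a" for x
    unfolding gderiv_def by (auto intro!: derivative_eq_intros)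
  then show ?thesis unfolding Suc by (rule C_k_SucI) (rule C_k_const)
qed (auto intro!: continuous_intros)

lemma GDERIV_quadratic:
  "GDERIV (\<lambda>x. d - c * ((x - a) \<bullet> (x - a))) x :> (- 2 * c) *\<^sub>R (x - a)"
  unfolding gderiv_def
  by (auto intro!: derivative_eq_intros simp: inner_commute algebra_simps)

lemma C_k_quadratic: "C_k n (\<lambda>x. d - c * ((x - a) \<bullet> (x - a)))"
proof (cases n)
  case (Suc m)
  show ?thesis unfolding Suc
  proof (rule C_k_SucI[OF GDERIV_quadratic])
    fix b :: 'a
    have "(\<lambda>x. ((- 2 * c) *\<^sub>R (x - a)) \<bullet> b) = (\<lambda>x. x \<bullet> ((- 2 * c) *\<^sub>R b) + 2 * c * (a \<bullet> b))"
      by (auto simp: inner_diff_left algebra_simps)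
    then show "C_k m (\<lambda>x. ((- 2 * c) *\<^sub>R (x - a)) \<bullet> b)"
      using C_k_affine by metis
  qed
qed (auto intro!: continuous_intros)

text \<open>The derivative of \<open>flat k\<close> is a linear combination of \<open>flat (k + 2)\<close> and \<open>flat (k + 1)\<close>, so the family
  is closed under differentiation.\<close>

definition flat :: "nat \<Rightarrow> real \<Rightarrow> real" where
  "flat k s = (if s > 0 then exp (- (1 / s)) / s ^ k else 0)"

lemma flat_tendsto_0: "(flat k \<longlongrightarrow> 0) (at_right 0)"
proof -
  have "((\<lambda>s. (1 / s) ^ k / exp (1 / s)) \<longlongrightarrow> (0::real)) (at_right 0)"
    by (rule filterlim_compose[OF tendsto_power_div_exp_0])
       (simp add: divide_inverse filterlim_inverse_at_top_right)
  moreover have "\<forall>\<^sub>F s in at_right 0. (1 / s) ^ k / exp (1 / s) = flat k s"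
    unfolding eventually_at_filter
    by (intro always_eventually) (auto simp: flat_def exp_minus field_simps)
  ultimately show ?thesis using tendsto_cong by fast
qed

lemma flat_deriv: "(flat k has_real_derivative (flat (k + 2) s - k * flat (k + 1) s)) (at s)"
proof -
  consider "s < 0" | "s = 0" | "s > 0" by linarith
  then show ?thesis
  proof cases
    case 1
    have "((\<lambda>_. 0) has_real_derivative 0) (at s)" by simp
    then have "(flat k has_real_derivative 0) (at s)"
      by (rule DERIV_cong_ev[THEN iffD1, rotated -1])
         (use 1 eventually_nhds_in_open[of "{..<0}" s] in \<open>auto simp: flat_def elim!: eventually_mono\<close>)
    with 1 show ?thesis by (simp add: flat_def)
  next
    case 2
    \<comment> \<open>For h > 0 the difference quotient at 0 is again a member of the family,
      \<open>flat (Suc k) h\<close>, so \<open>flat_tendsto_0\<close> at the next index settles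
      it.\<close>
    have "((\<lambda>h. flat k h / h) \<longlongrightarrow> 0) (at 0)"
    proof (rule filterlim_split_at)
      have "\<forall>\<^sub>F h in at_left 0. 0 = flat k h / h"
        unfolding eventually_at_filter by (intro always_eventually) (auto simp: flat_def)
      then show "((\<lambda>h. flat k h / h) \<longlongrightarrow> 0) (at_left 0)"
        using tendsto_cong[of "\<lambda>_. 0" "\<lambda>h. flat k h / h" "at_left 0" 0] by simp
      have "flat (Suc k) h = flat k h / h" for h by (simp add: flat_def)
      then show "((\<lambda>h. flat k h / h) \<longlongrightarrow> 0) (at_right 0)"
        using flat_tendsto_0[of "Suc k"] by presburger
    qed
    then show ?thesis using 2 by (simp add: DERIV_def flat_def)
  next
    case 3
    have "((\<lambda>s. exp (- (1 / s)) / s ^ k) has_real_derivative (flat (k + 2) s - k * flat (k + 1) s)) (at s)"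
    proof -
      have e: "((\<lambda>s. exp (- (1 / s))) has_real_derivative exp (- (1 / s)) / s\<^sup>2) (at s)"
        using 3 by (auto intro!: derivative_eq_intros simp: power2_eq_square)
      show ?thesis
      proof (cases k)
        case 0
        then show ?thesis using 3 e by (simp add: flat_def power2_eq_square)
      next
        case (Suc m)
        have "s ^ Suc m \<noteq> 0" using 3 by simp
        from DERIV_divide[OF e DERIV_power_Suc[OF DERIV_ident] this] show ?thesis
          unfolding Suc by (rule DERIV_cong) (use 3 in \<open>simp add: flat_def field_simps power2_eq_square\<close>)
      qed
    qed
    then show ?thesis
      by (rule DERIV_cong_ev[THEN iffD1, rotated -1])
         (use 3 eventually_nhds_in_open[of "{0<..}" s] in \<open>auto simp: flat_def elim!: eventually_mono\<close>)
  qed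
qed

text \<open>The index \<open>k\<close> stays free in the induction because each derivative raises it
  by one or two.\<close>

lemma C_k_flat:
  assumes "\<And>n. C_k n f"
  shows "C_k n (\<lambda>x. flat k (f x))"
proof (induction n arbitrary: k)
  case 0
  have "continuous_on UNIV (flat k)"
    by (intro DERIV_continuous_on[OF has_field_derivative_at_within[OF flat_deriv]])
  moreover have "continuous_on UNIV f" using assms[of 0] by simp
  ultimately show ?case by (simp add: continuous_on_compose2)
next
  case (Suc n)
  have f: "C_k (Suc n) f" by (rule assms)
  show ?case
  proof (rule C_k_SucI[OF GDERIV_DERIV_compose[OF C_k_SucD(1)[OF f] flat_deriv]])
    fix b :: 'a assume b: "b \<in> Basis"
    have "C_k n (\<lambda>x. (flat (k + 2) (f x) + (- k) * flat (k + 1) (f x)) * (grad f x \<bullet> b))"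
      by (intro C_k_mult C_k_add C_k_const Suc.IH C_k_SucD(2)[OF f] b)
    then show "C_k n (\<lambda>x. ((flat (k + 2) (f x) - k * flat (k + 1) (f x)) *\<^sub>R grad f x) \<bullet> b)"
      by simp
  qed
qed

lemma flat_0_bounds: "0 \<le> flat 0 s" "flat 0 s \<le> 1"
  by (auto simp: flat_def)

text \<open>Squashes a nonnegative test function into [0, 1] without enlarging its support. With
  \<open>c\<close> tending to infinity the result tends to 1 wherever \<phi> is positive, which is
  how indicators of open sets are approximated later.\<close>

lemma test_functions_flat:
  assumes "\<phi> \<in> test_functions U"
  shows "(\<lambda>x. flat 0 (c * \<phi> x)) \<in> test_functions U"
proof -
  have "{x. flat 0 (c * \<phi> x) \<noteq> 0} \<subseteq> {x. \<phi> x \<noteq> 0}" by (auto simp: flat_def)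
  then have "closure {x. flat 0 (c * \<phi> x) \<noteq> 0} \<subseteq> closure {x. \<phi> x \<noteq> 0}" by (rule closure_mono)
  moreover from this have "compact (closure {x. flat 0 (c * \<phi> x) \<noteq> 0})"
    using assms compact_Int_closed[of "closure {x. \<phi> x \<noteq> 0}" "closure {x. flat 0 (c * \<phi> x) \<noteq> 0}"]
    by (simp add: test_functions_def inf_absorb2)
  moreover have "C_k n (\<lambda>x. flat 0 (c * \<phi> x))" for n
    using assms by (intro C_k_flat C_k_mult C_k_const) (auto simp: test_functions_def)
  ultimately show ?thesis
    using assms unfolding test_functions_def by blast
qed

section \<open>Linear combinations of test functions\<close>

lemma test_functions_add:
  assumes "\<phi> \<in> test_functions U" "\<psi> \<in> test_functions U"
  shows "(\<lambda>x. \<phi> x + \<psi> x) \<in> test_functions U"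
proof -
  have "{x. \<phi> x + \<psi> x \<noteq> 0} \<subseteq> {x. \<phi> x \<noteq> 0} \<union> {x. \<psi> x \<noteq> 0}" by auto
  then have sub: "closure {x. \<phi> x + \<psi> x \<noteq> 0} \<subseteq> closure {x. \<phi> x \<noteq> 0} \<union> closure {x. \<psi> x \<noteq> 0}"
    using closure_mono closure_Un by metis
  moreover have "compact (closure {x. \<phi> x \<noteq> 0} \<union> closure {x. \<psi> x \<noteq> 0})"
    using assms by (auto simp: test_functions_def)
  ultimately have "compact (closure {x. \<phi> x + \<psi> x \<noteq> 0})"
    using compact_Int_closed[of "closure {x. \<phi> x \<noteq> 0} \<union> closure {x. \<psi> x \<noteq> 0}" "closure {x. \<phi> x + \<psi> x \<noteq> 0}"]
    by (simp add: inf_absorb2)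
  then show ?thesis
    using assms sub by (auto simp: test_functions_def intro!: C_k_add)
qed

lemma test_functions_cmult:
  assumes "\<phi> \<in> test_functions U"
  shows "(\<lambda>x. c * \<phi> x) \<in> test_functions U"
proof (cases "c = 0")
  case True
  then show ?thesis by (auto simp: test_functions_def C_k_const)
next
  case False
  then show ?thesis using assms by (auto simp: test_functions_def intro!: C_k_mult C_k_const)
qed

lemma test_functions_zero: "(\<lambda>x. 0) \<in> test_functions U"
  by (auto simp: test_functions_def C_k_const)

lemma test_functions_diff:
  assumes "\<phi> \<in> test_functions U" "\<psi> \<in> test_functions U"
  shows "(\<lambda>x. \<phi> x - \<psi> x) \<in> test_functions U"
  using test_functions_add[OF assms(1) test_functions_cmult[OF assms(2), of "-1"]] by simp

lemma test_functions_sum: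
  assumes "finite I" "\<And>i. i \<in> I \<Longrightarrow> \<phi> i \<in> test_functions U"
  shows "(\<lambda>x. \<Sum>i\<in>I. \<phi> i x) \<in> test_functions U"
  using assms
  by (induction I rule: finite_induct) (auto simp: test_functions_zero test_functions_add)

text \<open>The standard mollifier profile exp(-1/(1 - |y|^2)) in the variable y = (x - a)/r. It
  depends on y alone, which makes its Dirichlet energy in the plane independent of
  \<open>r\<close>.\<close>

definition bump :: "'a::euclidean_space \<Rightarrow> real \<Rightarrow> 'a \<Rightarrow> real" where
  "bump a r x = flat 0 (1 - (1 / r\<^sup>2) * ((x - a) \<bullet> (x - a)))"

lemma bump_nonzero_iff:
  assumes "r > 0"
  shows "bump a r x \<noteq> 0 \<longleftrightarrow> x \<in> ball a r"
proof -
  have "bump a r x \<noteq> 0 \<longleftrightarrow> (norm (x - a))\<^sup>2 < r\<^sup>2"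
    using assms by (simp add: bump_def flat_def power2_norm_eq_inner divide_simps)
  also have "\<dots> \<longleftrightarrow> norm (x - a) < r"
    using assms by (metis norm_ge_zero power_strict_mono less_imp_le power_less_imp_less_base zero_less_numeral)
  finally show ?thesis by (simp add: dist_norm norm_minus_commute)
qed

lemma bump_nonneg: "0 \<le> bump a r x"
  by (simp add: bump_def flat_0_bounds)

lemma bump_test_function:
  assumes "r > 0" "cball a r \<subseteq> U"
  shows "bump a r \<in> test_functions U"
proof -
  have "{x. bump a r x \<noteq> 0} = ball a r" by (simp only: bump_nonzero_iff[OF assms(1)] Collect_mem_eq)
  moreover have "C_k n (bump a r)" for n
    unfolding bump_def by (intro C_k_flat C_k_quadratic)
  ultimately show ?thesis using assms by (auto simp: test_functions_def)
qed

subsection \<open>Compactly supported functions of class C1\<close>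

text \<open>Wider than the test functions because truncations at a level are only C1. The gradient
  is carried along explicitly, and the extension by zero is required to be C1 on the whole space, so
  that integrals over the domain become integrals over the whole space.\<close>

definition C1_supp :: "'a::euclidean_space set \<Rightarrow> ('a \<Rightarrow> real) \<Rightarrow> ('a \<Rightarrow> 'a) \<Rightarrow> bool" where
  "C1_supp U f G \<longleftrightarrow> (\<forall>x. GDERIV f x :> G x) \<and> continuous_on UNIV G \<and>
     (\<exists>K. compact K \<and> K \<subseteq> U \<and> (\<forall>x. x \<notin> K \<longrightarrow> f x = 0 \<and> G x = 0))"

lemma continuous_on_GDERIV:
  assumes "\<And>x. x \<in> S \<Longrightarrow> GDERIV f x :> G x"
  shows "continuous_on S f"
  using assms
  by (intro continuous_at_imp_continuous_on ballI differentiable_imp_continuous_within)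
     (blast intro: differentiable_GDERIV)

lemma C1_supp_continuous:
  assumes "C1_supp U f G"
  shows "continuous_on UNIV f" "continuous_on UNIV G"
  using assms by (auto simp: C1_supp_def intro: continuous_on_GDERIV)

lemma C1_supp_measurable:
  assumes "C1_supp U f G"
  shows "f \<in> borel_measurable borel" "G \<in> borel_measurable borel"
  using C1_supp_continuous[OF assms] by (auto intro: borel_measurable_continuous_onI)

lemma integrable_compact_support:
  fixes f :: "'a::euclidean_space \<Rightarrow> 'b::{banach, second_countable_topology}"
  assumes "continuous_on UNIV f" "compact K" "\<And>x. x \<notin> K \<Longrightarrow> f x = 0"
  shows "integrable lborel f"
proof -
  have "integrable lborel (\<lambda>x. indicator K x *\<^sub>R f x)"
    using assms by (intro borel_integrable_compact) (auto intro: continuous_on_subset)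
  moreover have "(\<lambda>x. indicator K x *\<^sub>R f x) = f"
    using assms(3) by (auto simp: indicator_def)
  ultimately show ?thesis by simp
qed

lemma bounded_compact_support:
  fixes f :: "'a::euclidean_space \<Rightarrow> 'b::real_normed_vector"
  assumes "continuous_on UNIV f" "compact K" "\<And>x. x \<notin> K \<Longrightarrow> f x = 0"
  obtains B where "B > 0" "\<And>x. norm (f x) \<le> B"
proof -
  have "compact (f ` K)" using assms by (auto intro: compact_continuous_image continuous_on_subset)
  then obtain B where "B > 0" "\<forall>y\<in>f ` K. norm y \<le> B"
    using compact_imp_bounded bounded_pos by metis
  then show thesis using that[of B] assms(3)
    by (metis imageI less_imp_le norm_zero)
qed

text \<open>Translation invariance makes the integral of each difference quotient vanish.\<close>

lemma integral_GDERIV_zero: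
  fixes f :: "'a::euclidean_space \<Rightarrow> real"
  assumes "C1_supp U f G"
  shows "(\<integral>x. G x \<bullet> b \<partial>lborel) = 0"
proof -
  obtain K where K: "compact K" "\<And>x. x \<notin> K \<Longrightarrow> f x = 0 \<and> G x = 0"
    and f: "\<And>x. GDERIV f x :> G x"
    using assms by (auto simp: C1_supp_def)
  note cont = C1_supp_continuous[OF assms] and [measurable] = C1_supp_measurable[OF assms]
  obtain B where B: "B > 0" "\<And>x. norm (G x) \<le> B"
    using bounded_compact_support[OF cont(2) K(1)] K(2) by metis
  obtain R where R: "\<And>x. x \<in> K \<Longrightarrow> norm x \<le> R"
    using compact_imp_bounded[OF K(1)] bounded_iff by metis
  have lip: "\<bar>f x - f y\<bar> \<le> B * norm (x - y)" for x y
  proof -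
    have "norm (f x - f y) \<le> B * norm (x - y)"
    proof (rule differentiable_bound)
      show "(f has_derivative (\<lambda>h. h \<bullet> G x)) (at x within UNIV)" for x
        using f[of x] by (simp add: gderiv_def)
      show "onorm (\<lambda>h. h \<bullet> G x) \<le> B" for x
      proof (rule onorm_bound)
        fix h
        have "norm (h \<bullet> G x) \<le> norm h * norm (G x)" using Cauchy_Schwarz_ineq2 by auto
        also have "\<dots> \<le> norm h * B" by (intro mult_left_mono B) auto
        finally show "norm (h \<bullet> G x) \<le> B * norm h" by (simp add: mult.commute)
      qed (use B in auto)
    qed auto
    then show ?thesis by simp
  qed
  define t :: "nat \<Rightarrow> real" where "t n = 1 / Suc n" for n
  have t: "0 < t n" "t n \<le> 1" for n by (auto simp: t_def)
  have t0: "t \<longlonglongrightarrow> 0" unfolding t_def by (rule LIMSEQ_Suc[OF lim_1_over_n])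
  have int: "integrable lborel f" using integrable_compact_support[OF cont(1) K(1)] K(2) by blast
  define s where "s n x = (f (t n *\<^sub>R b + x) - f x) / t n" for n x
  have "(\<lambda>n. \<integral>x. s n x \<partial>lborel) \<longlonglongrightarrow> (\<integral>x. G x \<bullet> b \<partial>lborel)"
  \<comment> \<open>The bound is the Lipschitz constant times |b|. As \<open>t n \<le> 1\<close>,
    all difference quotients vanish outside one ball, whose radius exceeds that of the support by
    |b|.\<close>
  proof (rule integral_dominated_convergence[where w="\<lambda>x. indicator (cball 0 (R + norm b)) x *\<^sub>R (B * norm b)"])
    show "integrable lborel (\<lambda>x. indicator (cball 0 (R + norm b)) x *\<^sub>R (B * norm b))"
      by (intro borel_integrable_compact) auto
    show "AE x in lborel. (\<lambda>n. s n x) \<longlonglongrightarrow> G x \<bullet> b"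
    proof (rule AE_I2)
      fix x
      have "((\<lambda>u. f (u *\<^sub>R b + x)) has_derivative (\<lambda>h. h * (b \<bullet> G x))) (at 0)"
      proof -
        have 1: "((\<lambda>u. u *\<^sub>R b + x) has_derivative (\<lambda>h. h *\<^sub>R b)) (at (0::real))"
          by (auto intro!: derivative_eq_intros)
        have 2: "(f has_derivative (\<lambda>h. h \<bullet> G x)) (at (0 *\<^sub>R b + x))"
          using f[of x] by (simp add: gderiv_def)
        show ?thesis using has_derivative_compose[OF 1 2] by simp
      qed
      then have "((\<lambda>u. f (u *\<^sub>R b + x)) has_real_derivative (b \<bullet> G x)) (at 0)"
        by (simp add: has_field_derivative_def mult.commute[of _ "b \<bullet> G x"])
      then have lim: "((\<lambda>h. (f (h *\<^sub>R b + x) - f x) / h) \<longlongrightarrow> b \<bullet> G x) (at 0)"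
        by (simp add: DERIV_def)
      have "filterlim t (at 0) sequentially"
        using t0 t(1) by (auto simp: filterlim_at intro!: always_eventually) (metis less_irrefl)
      from filterlim_compose[OF lim this] show "(\<lambda>n. s n x) \<longlonglongrightarrow> G x \<bullet> b"
        by (simp add: s_def inner_commute)
    qed
    show "AE x in lborel. norm (s n x) \<le> indicator (cball 0 (R + norm b)) x *\<^sub>R (B * norm b)" for n
    proof (rule AE_I2)
      fix x
      have *: "\<bar>s n x\<bar> \<le> B * norm b"
        using lip[of "t n *\<^sub>R b + x" x] t[of n] by (simp add: s_def field_simps)
      have "s n x = 0" if "norm x > R + norm b"
      proof -
        have "norm x > R" using that norm_ge_zero[of b] by linarith
        moreover have "norm (t n *\<^sub>R b + x) > R"
        proof -
          have "norm x \<le> norm (t n *\<^sub>R b + x) + norm (t n *\<^sub>R b)"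
            by (metis add_diff_cancel_left' norm_triangle_sub norm_minus_commute add.commute norm_triangle_ineq4)
          moreover have "norm (t n *\<^sub>R b) \<le> norm b"
            using t[of n] by (simp add: mult_left_le_one_le)
          ultimately show ?thesis using that by linarith
        qed
        ultimately have "x \<notin> K" "t n *\<^sub>R b + x \<notin> K" using R by force+
        then show ?thesis using K(2) by (simp add: s_def)
      qed
      then show "norm (s n x) \<le> indicator (cball 0 (R + norm b)) x *\<^sub>R (B * norm b)"
        using * by (auto simp: indicator_def)
    qed
  qed (auto simp: s_def)
  moreover have "(\<integral>x. s n x \<partial>lborel) = 0" for n
  proof -
    have d: "distr lborel borel ((+) (t n *\<^sub>R b)) = lborel" by (rule lborel_distr_plus)
    have "(\<integral>x. f (t n *\<^sub>R b + x) \<partial>lborel) = (\<integral>x. f x \<partial>lborel)"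
      using integral_distr[of "(+) (t n *\<^sub>R b)" lborel borel f] d by simp
    moreover have "integrable lborel (\<lambda>x. f (t n *\<^sub>R b + x))"
      using integrable_distr[of "(+) (t n *\<^sub>R b)" lborel borel f] d int by simp
    ultimately show ?thesis using int by (simp add: s_def)
  qed
  ultimately show ?thesis by (simp add: LIMSEQ_const_iff)
qed

lemma C1_supp_compose:
  assumes "C1_supp U f G" "\<And>y. (h has_real_derivative h' y) (at y)" "continuous_on UNIV h'" "h 0 = 0"
  shows "C1_supp U (\<lambda>x. h (f x)) (\<lambda>x. h' (f x) *\<^sub>R G x)"
proof -
  have "continuous_on UNIV (\<lambda>x. h' (f x) *\<^sub>R G x)"
    using C1_supp_continuous[OF assms(1)] continuous_on_compose2[OF assms(3)]
    by (intro continuous_on_scaleR) auto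
  moreover have "GDERIV (\<lambda>x. h (f x)) x :> h' (f x) *\<^sub>R G x" for x
    using assms(1,2) by (auto simp: C1_supp_def intro: GDERIV_DERIV_compose)
  moreover obtain K where "compact K" "K \<subseteq> U" "\<And>x. x \<notin> K \<Longrightarrow> f x = 0 \<and> G x = 0"
    using assms(1) by (auto simp: C1_supp_def)
  ultimately show ?thesis using assms(4) unfolding C1_supp_def
    by (intro conjI exI[of _ K]) auto
qed

text \<open>Only \<open>f\<close> must be globally C1: since it vanishes off a compact subset of
  \<open>U\<close>, the product is 0 near every point outside \<open>U\<close>, whatever
  \<open>h\<close> is there. This admits factors that blow up at the boundary, such as 1 / (1 -
  |x|^2).\<close>

lemma C1_supp_mult:
  assumes f: "C1_supp U f G" and "open U"
    and h: "\<And>x. x \<in> U \<Longrightarrow> GDERIV h x :> H x" and H: "continuous_on U H"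
  shows "C1_supp U (\<lambda>x. f x * h x) (\<lambda>x. f x *\<^sub>R H x + h x *\<^sub>R G x)"
proof -
  obtain K where K: "compact K" "K \<subseteq> U" "\<And>x. x \<notin> K \<Longrightarrow> f x = 0 \<and> G x = 0"
    using f by (auto simp: C1_supp_def)
  let ?D = "\<lambda>x. f x *\<^sub>R H x + h x *\<^sub>R G x"
  have oK: "open (- K)" using K(1) by (simp add: compact_imp_closed open_Compl)
  have "GDERIV (\<lambda>x. f x * h x) x :> ?D x" for x
  proof (cases "x \<in> U")
    case True
    then show ?thesis using f h by (auto simp: C1_supp_def intro: GDERIV_mult)
  next
    case False
    then have "x \<in> - K" using K(2) by auto
    moreover have "((\<lambda>_. 0) has_derivative (\<lambda>_. 0)) (at x)" by simp
    ultimately have "((\<lambda>x. f x * h x) has_derivative (\<lambda>_. 0)) (at x)"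
      by (rule_tac has_derivative_transform_within_open[OF _ oK]) (use K(3) in auto)
    then show ?thesis using \<open>x \<in> - K\<close> K(3) by (simp add: gderiv_def)
  qed
  moreover have "continuous_on UNIV ?D"
  proof -
    have "continuous_on U ?D"
      using C1_supp_continuous[OF f] continuous_on_GDERIV[of U h H, OF h] H
      by (intro continuous_intros) (auto intro: continuous_on_subset)
    moreover have "continuous_on (- K) ?D"
      using K(3) by (subst continuous_on_cong[where g="\<lambda>_. 0"]) auto
    ultimately have "continuous_on (U \<union> - K) ?D"
      using \<open>open U\<close> oK by (intro continuous_on_open_Un)
    moreover have "U \<union> - K = UNIV" using K(2) by auto
    ultimately show ?thesis by simp
  qed
  ultimately show ?thesis unfolding C1_supp_def using K
    by (intro conjI allI exI[of _ K]) auto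
qed

lemma C1_supp_prod:
  assumes "C1_supp U f F" "C1_supp U g G"
  shows "C1_supp U (\<lambda>x. f x * g x) (\<lambda>x. f x *\<^sub>R G x + g x *\<^sub>R F x)"
proof -
  have "C1_supp UNIV f F" if "C1_supp U f F" for f F using that by (auto simp: C1_supp_def)
  then have "C1_supp UNIV (\<lambda>x. f x * g x) (\<lambda>x. f x *\<^sub>R G x + g x *\<^sub>R F x)"
    using assms by (intro C1_supp_mult) (auto simp: C1_supp_def)
  moreover obtain K where "compact K" "K \<subseteq> U" "\<forall>x. x \<notin> K \<longrightarrow> f x = 0 \<and> F x = 0"
    using assms(1) by (auto simp: C1_supp_def)
  ultimately show ?thesis unfolding C1_supp_def
    by (intro conjI exI[of _ K]) auto
qed

lemma test_function_C1_supp: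
  assumes "\<phi> \<in> test_functions U"
  shows "C1_supp U \<phi> (grad \<phi>)"
proof -
  let ?K = "closure {x. \<phi> x \<noteq> 0}"
  have C: "C_k n \<phi>" for n using assms by (auto simp: test_functions_def)
  have G: "GDERIV \<phi> x :> grad \<phi> x" for x using C_k_SucD(1)[OF C] .
  have "continuous_on UNIV (\<lambda>x. grad \<phi> x \<bullet> b)" if "b \<in> Basis" for b
    using C_k_SucD(2)[OF C[of "Suc 0"] that] by simp
  then have cont: "continuous_on UNIV (grad \<phi>)" by (rule continuous_on_componentwise[THEN iffD2, rule_format])
  have K0: "\<phi> x = 0" if "x \<notin> ?K" for x
    using that closure_subset[of "{x. \<phi> x \<noteq> 0}"] by blast
  have zero: "\<phi> x = 0 \<and> grad \<phi> x = 0" if x: "x \<notin> ?K" for x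
  proof -
    have "((\<lambda>_. 0) has_derivative (\<lambda>_. 0)) (at x)" by simp
    then have "(\<phi> has_derivative (\<lambda>_. 0)) (at x)"
    proof (rule has_derivative_transform_within_open)
      show "open (- ?K)" by (simp add: open_Compl)
      show "x \<in> - ?K" using x by blast
      show "0 = \<phi> y" if "y \<in> - ?K" for y using K0[of y] that by simp
    qed
    then have "GDERIV \<phi> x :> 0" by (simp add: gderiv_def)
    then show ?thesis using grad_eqI K0[OF x] by blast
  qed
  have "compact ?K" "?K \<subseteq> U" using assms by (auto simp: test_functions_def)
  then have "\<exists>K. compact K \<and> K \<subseteq> U \<and> (\<forall>x. x \<notin> K \<longrightarrow> \<phi> x = 0 \<and> grad \<phi> x = 0)"
    using zero by (intro exI[of _ ?K] conjI allI impI) metis+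
  then show ?thesis unfolding C1_supp_def using cont G by metis
qed

text \<open>The bridge from the restricted Lebesgue measure of the definitions to
  \<open>lborel\<close>, on which translation invariance, Fubini and densities are used.\<close>

lemma integral_lebesgue_on_eq:
  fixes f :: "'a::euclidean_space \<Rightarrow> 'b::{banach, second_countable_topology}"
  assumes "U \<in> sets borel" "f \<in> borel_measurable borel" "\<And>x. x \<notin> U \<Longrightarrow> f x = 0"
  shows "(\<integral>x. f x \<partial>lebesgue_on U) = (\<integral>x. f x \<partial>lborel)"
    and "integrable (lebesgue_on U) f \<longleftrightarrow> integrable lborel f"
proof -
  have "(\<lambda>x. indicator U x *\<^sub>R f x) = f"
    using assms(3) by (intro ext) (simp add: indicator_def)
  then show "(\<integral>x. f x \<partial>lebesgue_on U) = (\<integral>x. f x \<partial>lborel)"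
    "integrable (lebesgue_on U) f \<longleftrightarrow> integrable lborel f"
    using assms(1,2) by (simp_all add: integral_restrict_space integrable_restrict_space integral_completion integrable_completion)
qed

lemma C1_supp_integral_by_parts:
  assumes "open U" "C1_supp U f G" "C1_supp U g H"
  shows "(\<integral>x. f x * (H x \<bullet> b) \<partial>lebesgue_on U) = - (\<integral>x. (G x \<bullet> b) * g x \<partial>lebesgue_on U)"
proof -
  note [measurable] = C1_supp_measurable[OF assms(2)] C1_supp_measurable[OF assms(3)]
  note cont = C1_supp_continuous[OF assms(2)] C1_supp_continuous[OF assms(3)]
  have U[measurable]: "U \<in> sets borel" using assms(1) by simp
  obtain K where K: "compact K" "K \<subseteq> U" "\<And>x. x \<notin> K \<Longrightarrow> f x = 0 \<and> G x = 0"
    using assms(2) by (auto simp: C1_supp_def)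
  have KU: "\<And>x. x \<notin> U \<Longrightarrow> f x = 0 \<and> G x = 0" using K by auto
  have i2: "integrable lborel (\<lambda>x. f x * (H x \<bullet> b))"
    using K cont by (intro integrable_compact_support[where K=K] continuous_intros) auto
  have i3: "integrable lborel (\<lambda>x. (G x \<bullet> b) * g x)"
    using K cont by (intro integrable_compact_support[where K=K] continuous_intros) auto
  have "(\<integral>x. (f x *\<^sub>R H x + g x *\<^sub>R G x) \<bullet> b \<partial>lborel) = 0"
    by (rule integral_GDERIV_zero[OF C1_supp_prod[OF assms(2,3)]])
  moreover have "(\<integral>x. (f x *\<^sub>R H x + g x *\<^sub>R G x) \<bullet> b \<partial>lborel) =
      (\<integral>x. f x * (H x \<bullet> b) \<partial>lborel) + (\<integral>x. (G x \<bullet> b) * g x \<partial>lborel)"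
    using i2 i3 by (simp add: inner_add_left mult.commute)
  moreover have "(\<integral>x. f x * (H x \<bullet> b) \<partial>lebesgue_on U) = (\<integral>x. f x * (H x \<bullet> b) \<partial>lborel)"
    using KU by (intro integral_lebesgue_on_eq) auto
  moreover have "(\<integral>x. (G x \<bullet> b) * g x \<partial>lebesgue_on U) = (\<integral>x. (G x \<bullet> b) * g x \<partial>lborel)"
    using KU by (intro integral_lebesgue_on_eq) auto
  ultimately show "(\<integral>x. f x * (H x \<bullet> b) \<partial>lebesgue_on U) = - (\<integral>x. (G x \<bullet> b) * g x \<partial>lebesgue_on U)"
    by linarith
qed

subsection \<open>Hardy and Sobolev inequalities in the hyperbolic plane\<close>

definition vec2 :: "real \<times> real \<Rightarrow> real^2" where
  "vec2 p = fst p *\<^sub>R axis 1 1 + snd p *\<^sub>R axis 2 1"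

lemma Basis_2: "(Basis :: (real^2) set) = {axis 1 1, axis 2 1}"
  by (auto simp: Basis_vec_def UNIV_2)

lemma axis_12: "axis 1 1 \<noteq> (axis 2 1 :: real^2)"
  by (simp add: axis_eq_axis)

lemma vec2_inner: "vec2 p \<bullet> axis 1 1 = fst p" "vec2 p \<bullet> axis 2 1 = snd p"
  by (auto simp: vec2_def inner_add_left inner_axis_axis)

lemma vec2_measurable [measurable]: "vec2 \<in> lborel \<Otimes>\<^sub>M lborel \<rightarrow>\<^sub>M borel"
  unfolding vec2_def by (simp add: lborel_prod borel_measurable_continuous_onI continuous_intros)

text \<open>Lets Fubini for pairs act on \<open>real^2\<close>. A measure with the right values on
  boxes is \<open>lborel\<close>, and the preimage of a box is a product of intervals.\<close>

lemma lborel_vec2: "lborel = distr (lborel \<Otimes>\<^sub>M lborel) borel vec2"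
proof (rule lborel_eqI)
  fix l u :: "real^2"
  assume le: "\<And>b. b \<in> Basis \<Longrightarrow> l \<bullet> b \<le> u \<bullet> b"
  have "vec2 -` box l u = {l \<bullet> axis 1 1 <..< u \<bullet> axis 1 1} \<times> {l \<bullet> axis 2 1 <..< u \<bullet> axis 2 1}"
    by (auto simp: box_def Basis_2 vec2_inner)
  then show "emeasure (distr (lborel \<Otimes>\<^sub>M lborel) borel vec2) (box l u) = ennreal (\<Prod>b\<in>Basis. (u - l) \<bullet> b)"
    using le by (simp add: emeasure_distr lborel.emeasure_pair_measure_Times
       Basis_2 axis_12 inner_diff_left ennreal_mult space_pair_measure)
qed simp

lemma abs_le_nn_integral_deriv:
  fixes f :: "real \<Rightarrow> real"
  assumes "\<And>x. (f has_real_derivative f' x) (at x)" "continuous_on UNIV f'" "\<And>x. \<bar>x\<bar> > R \<Longrightarrow> f x = 0"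
  shows "ennreal \<bar>f s\<bar> \<le> (\<integral>\<^sup>+x. ennreal \<bar>f' x\<bar> \<partial>lborel)"
proof -
  \<comment> \<open>A point not to the right of \<open>s\<close> with |a| > \<open>R\<close>, so
    that \<open>f\<close> vanishes there; the absolute value covers negative
    \<open>R\<close>.\<close>
  define a where "a = min s (- \<bar>R\<bar> - 1)"
  have "f a = 0" using assms(3)[of a] by (simp add: a_def)
  have "has_bochner_integral lborel (\<lambda>x. indicator {a..s} x *\<^sub>R f' x) (f s - f a)"
    using assms(1,2) by (intro has_bochner_integral_FTC_Icc)
      (auto simp: a_def has_real_derivative_iff_has_vector_derivative
        intro: has_vector_derivative_at_within continuous_on_subset)
  then have "ennreal (norm (f s)) \<le> (\<integral>\<^sup>+x. ennreal (norm (indicator {a..s} x *\<^sub>R f' x)) \<partial>lborel)"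
    using \<open>f a = 0\<close> integral_norm_bound_ennreal[of lborel "\<lambda>x. indicator {a..s} x *\<^sub>R f' x"]
    by (simp add: has_bochner_integral_iff)
  also have "\<dots> \<le> (\<integral>\<^sup>+x. ennreal \<bar>f' x\<bar> \<partial>lborel)"
    by (intro nn_integral_mono) (auto simp: indicator_def)
  finally show ?thesis by simp
qed

text \<open>Integrating along a horizontal and along a vertical line bounds |v| at (x, y) by a
  function of \<open>y\<close> alone and by a function of \<open>x\<close> alone. Their product
  bounds the square of \<open>v\<close>, and its integral factorises.\<close>

lemma gagliardo_nirenberg:
  assumes "C1_supp U (v :: real^2 \<Rightarrow> real) V"
  shows "(\<integral>\<^sup>+x. ennreal ((v x)\<^sup>2) \<partial>lborel) \<le> (\<integral>\<^sup>+x. ennreal (norm (V x)) \<partial>lborel)\<^sup>2"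
proof -
  obtain K where K: "compact K" "\<And>x. x \<notin> K \<Longrightarrow> v x = 0" and v: "\<And>x. GDERIV v x :> V x"
    using assms by (auto simp: C1_supp_def)
  obtain R where R: "\<And>x. x \<in> K \<Longrightarrow> norm x \<le> R"
    using compact_imp_bounded[OF K(1)] bounded_iff by metis
  note cont = C1_supp_continuous[OF assms] and [measurable] = C1_supp_measurable[OF assms]
  have nrm: "\<bar>fst p\<bar> \<le> norm (vec2 p)" "\<bar>snd p\<bar> \<le> norm (vec2 p)" for p
    using Basis_le_norm[of "axis 1 1 :: real^2" "vec2 p"] Basis_le_norm[of "axis 2 1 :: real^2" "vec2 p"]
    by (auto simp: vec2_inner Basis_2)
  define a where "a y = (\<integral>\<^sup>+s. ennreal \<bar>V (vec2 (s, y)) \<bullet> axis 1 1\<bar> \<partial>lborel)" for y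
  define b where "b x = (\<integral>\<^sup>+s. ennreal \<bar>V (vec2 (x, s)) \<bullet> axis 2 1\<bar> \<partial>lborel)" for x
  have va: "ennreal \<bar>v (vec2 (x, y))\<bar> \<le> a y" for x y
    unfolding a_def
  proof (rule abs_le_nn_integral_deriv[where f="\<lambda>x. v (vec2 (x, y))" and R=R])
    fix x
    have 1: "((\<lambda>x. vec2 (x, y)) has_derivative (\<lambda>h. h *\<^sub>R axis 1 1)) (at x)"
      unfolding vec2_def by (auto intro!: derivative_eq_intros)
    have 2: "(v has_derivative (\<lambda>h. h \<bullet> V (vec2 (x, y)))) (at (vec2 (x, y)))"
      using v by (simp add: gderiv_def)
    show "((\<lambda>x. v (vec2 (x, y))) has_real_derivative V (vec2 (x, y)) \<bullet> axis 1 1) (at x)"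
      using has_derivative_compose[OF 1 2]
      by (simp add: has_field_derivative_def inner_commute mult.commute[of _ "_ \<bullet> _"])
  next
    show "continuous_on UNIV (\<lambda>x. V (vec2 (x, y)) \<bullet> axis 1 1)"
      unfolding vec2_def by (intro continuous_intros continuous_on_compose2[OF cont(2)]) auto
    show "v (vec2 (x, y)) = 0" if "\<bar>x\<bar> > R" for x
      using K(2) R[of "vec2 (x, y)"] nrm(1)[of "(x, y)"] that by force
  qed
  have vb: "ennreal \<bar>v (vec2 (x, y))\<bar> \<le> b x" for x y
    unfolding b_def
  proof (rule abs_le_nn_integral_deriv[where f="\<lambda>y. v (vec2 (x, y))" and R=R])
    fix y
    have 1: "((\<lambda>y. vec2 (x, y)) has_derivative (\<lambda>h. h *\<^sub>R axis 2 1)) (at y)"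
      unfolding vec2_def by (auto intro!: derivative_eq_intros)
    have 2: "(v has_derivative (\<lambda>h. h \<bullet> V (vec2 (x, y)))) (at (vec2 (x, y)))"
      using v by (simp add: gderiv_def)
    show "((\<lambda>y. v (vec2 (x, y))) has_real_derivative V (vec2 (x, y)) \<bullet> axis 2 1) (at y)"
      using has_derivative_compose[OF 1 2]
      by (simp add: has_field_derivative_def inner_commute mult.commute[of _ "_ \<bullet> _"])
  next
    show "continuous_on UNIV (\<lambda>y. V (vec2 (x, y)) \<bullet> axis 2 1)"
      unfolding vec2_def by (intro continuous_intros continuous_on_compose2[OF cont(2)]) auto
    show "v (vec2 (x, y)) = 0" if "\<bar>y\<bar> > R" for y
      using K(2) R[of "vec2 (x, y)"] nrm(2)[of "(x, y)"] that by force
  qed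
  have [measurable]: "a \<in> borel_measurable borel" "b \<in> borel_measurable borel"
    unfolding a_def b_def by measurable
  have fub: "(\<integral>\<^sup>+x. g x \<partial>lborel) = (\<integral>\<^sup>+x. \<integral>\<^sup>+y. g (vec2 (x, y)) \<partial>lborel \<partial>lborel)"
    if [measurable]: "g \<in> borel_measurable borel" for g :: "real^2 \<Rightarrow> ennreal"
    by (subst lborel_vec2)
       (simp add: nn_integral_distr lborel.nn_integral_fst[of "\<lambda>p. g (vec2 p)" lborel, symmetric])
  have "(\<integral>\<^sup>+x. ennreal ((v x)\<^sup>2) \<partial>lborel) = (\<integral>\<^sup>+x. \<integral>\<^sup>+y. ennreal ((v (vec2 (x, y)))\<^sup>2) \<partial>lborel \<partial>lborel)"
    by (rule fub) simp
  also have "\<dots> \<le> (\<integral>\<^sup>+x. \<integral>\<^sup>+y. b x * a y \<partial>lborel \<partial>lborel)"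
  proof (intro nn_integral_mono)
    fix x y
    have "ennreal ((v (vec2 (x, y)))\<^sup>2) = ennreal \<bar>v (vec2 (x, y))\<bar> * ennreal \<bar>v (vec2 (x, y))\<bar>"
      by (simp add: power2_eq_square flip: ennreal_mult abs_mult)
    also have "\<dots> \<le> b x * a y" by (intro mult_mono va vb) auto
    finally show "ennreal ((v (vec2 (x, y)))\<^sup>2) \<le> b x * a y" .
  qed
  also have "\<dots> = (\<integral>\<^sup>+x. b x \<partial>lborel) * (\<integral>\<^sup>+y. a y \<partial>lborel)"
    by (simp add: nn_integral_cmult nn_integral_multc)
  also have "(\<integral>\<^sup>+x. b x \<partial>lborel) = (\<integral>\<^sup>+x. ennreal \<bar>V x \<bullet> axis 2 1\<bar> \<partial>lborel)"
    unfolding b_def by (rule fub[symmetric]) simp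
  also have "(\<integral>\<^sup>+y. a y \<partial>lborel) = (\<integral>\<^sup>+x. ennreal \<bar>V x \<bullet> axis 1 1\<bar> \<partial>lborel)"
    unfolding a_def by (subst fub) (auto intro!: lborel_pair.Fubini')
  also have "(\<integral>\<^sup>+x. ennreal \<bar>V x \<bullet> axis 2 1\<bar> \<partial>lborel) * (\<integral>\<^sup>+x. ennreal \<bar>V x \<bullet> axis 1 1\<bar> \<partial>lborel)
      \<le> (\<integral>\<^sup>+x. ennreal (norm (V x)) \<partial>lborel) * (\<integral>\<^sup>+x. ennreal (norm (V x)) \<partial>lborel)"
    by (intro mult_mono nn_integral_mono ennreal_leI Basis_le_norm) (auto simp: Basis_2)
  finally show ?thesis by (simp add: power2_eq_square)
qed

text \<open>A quarter of the area measure of the Poincare disk. The density is not cut off at the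
  unit circle, since the functions integrated against it vanish outside the disk or serve as upper
  bounds.\<close>

definition hyp :: "(real^2) measure" where
  "hyp = density lborel (\<lambda>x. ennreal ((inverse (1 - x \<bullet> x))\<^sup>2))"

lemma sets_hyp [simp, measurable_cong]: "sets hyp = sets borel"
  by (simp add: hyp_def)

lemma space_hyp [simp]: "space hyp = UNIV"
  by (simp add: hyp_def)

lemma nn_integral_hyp:
  assumes [measurable]: "f \<in> borel_measurable borel"
  shows "(\<integral>\<^sup>+x. f x \<partial>hyp) = (\<integral>\<^sup>+x. ennreal ((inverse (1 - x \<bullet> x))\<^sup>2) * f x \<partial>lborel)"
  unfolding hyp_def by (rule nn_integral_density) auto

lemma ball01_iff: "x \<in> ball 0 1 \<longleftrightarrow> x \<bullet> x < (1::real)"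
  using power_strict_mono[of "norm x" 1 2] power_less_imp_less_base[of "norm x" 2 1]
  by (auto simp flip: power2_norm_eq_inner)

lemma C1_supp_integrable:
  assumes "C1_supp U f G"
  shows "integrable lborel f" "integrable lborel (\<lambda>x. G x \<bullet> b)"
proof -
  obtain K where K: "compact K" "\<And>x. x \<notin> K \<Longrightarrow> f x = 0 \<and> G x = 0"
    using assms by (auto simp: C1_supp_def)
  note cont = C1_supp_continuous[OF assms]
  show "integrable lborel f" using K cont by (intro integrable_compact_support[where K=K]) auto
  show "integrable lborel (\<lambda>x. G x \<bullet> b)"
    using K cont by (intro integrable_compact_support[where K=K] continuous_intros) auto
qed

lemma C1_supp_outside:
  assumes "C1_supp U f G" "x \<notin> U"
  shows "f x = 0" "G x = 0"
  using assms by (auto simp: C1_supp_def)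

lemma GDERIV_inverse_rho:
  assumes "x \<in> ball 0 1"
  shows "GDERIV (\<lambda>x. inverse (1 - x \<bullet> x)) x :> (2 * (inverse (1 - x \<bullet> x))\<^sup>2) *\<^sub>R x"
proof -
  have 1: "GDERIV (\<lambda>x. 1 - x \<bullet> x) x :> (- 2) *\<^sub>R x"
    unfolding gderiv_def by (auto intro!: derivative_eq_intros simp: inner_commute)
  have "1 - x \<bullet> x \<noteq> 0" using assms[unfolded ball01_iff] by simp
  from GDERIV_inverse[OF 1 this] show ?thesis by (simp add: mult.commute)
qed

lemma continuous_inverse_rho: "continuous_on (ball 0 1) (\<lambda>x. inverse (1 - x \<bullet> x))"
  by (intro continuous_intros ballI) (metis ball01_iff eq_iff_diff_eq_0 less_irrefl)

lemma C1_supp_inverse_rho: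
  assumes "C1_supp (ball 0 1) f G"
  shows "C1_supp (ball 0 1) (\<lambda>x. f x * inverse (1 - x \<bullet> x))
    (\<lambda>x. f x *\<^sub>R ((2 * (inverse (1 - x \<bullet> x))\<^sup>2) *\<^sub>R x) + inverse (1 - x \<bullet> x) *\<^sub>R G x)"
  by (intro C1_supp_mult assms GDERIV_inverse_rho continuous_intros continuous_inverse_rho) auto

text \<open>The vector field \<open>x / (1 - |x|\<^sup>2)\<close> has divergence \<open>2 / (1 - |x|\<^sup>2)\<^sup>2\<close>.\<close>

lemma hardy_L1:
  fixes f :: "real^2 \<Rightarrow> real"
  assumes f: "C1_supp (ball 0 1) f G" and nonneg: "\<And>x. f x \<ge> 0"
  shows "2 * (\<integral>\<^sup>+x. ennreal (f x) \<partial>hyp) \<le> (\<integral>\<^sup>+x. ennreal (inverse (1 - x \<bullet> x)) * ennreal (norm (G x)) \<partial>lborel)"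
proof -
  note [measurable] = C1_supp_measurable[OF f]
  define i where "i x = inverse (1 - x \<bullet> x)" for x :: "real^2"
  have [measurable]: "i \<in> borel_measurable borel" unfolding i_def by measurable
  define h where "h b x = (x \<bullet> b) * i x" for b x :: "real^2"
  define H where "H b x = (x \<bullet> b) *\<^sub>R ((2 * (i x)\<^sup>2) *\<^sub>R x) + i x *\<^sub>R b" for b x :: "real^2"
  \<comment> \<open>\<open>Z b\<close> is the gradient of \<open>f\<close> times the
    \<open>b\<close>-th component of the field, so the sum of \<open>Z b x \<bullet> b\<close> is
    the divergence of \<open>f\<close> times the field, which has integral zero.\<close>
  define Z where "Z b x = (f x *\<^sub>R H b x + h b x *\<^sub>R G x)" for b x
  have C: "C1_supp (ball 0 1) (\<lambda>x. f x * h b x) (Z b)" for b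
    unfolding Z_def
  proof (rule C1_supp_mult[OF f open_ball])
    have 1: "GDERIV (\<lambda>x. x \<bullet> b) x :> b" for x
      unfolding gderiv_def by (auto intro!: derivative_eq_intros)
    show "GDERIV (h b) x :> H b x" if "x \<in> ball 0 1" for x
      using GDERIV_mult[OF 1 GDERIV_inverse_rho[OF that]] unfolding h_def H_def i_def by simp
    show "continuous_on (ball 0 1) (H b)"
      unfolding H_def unfolding i_def by (intro continuous_intros continuous_inverse_rho)
  qed
  have sumZ: "(\<Sum>b\<in>Basis. Z b x \<bullet> b) = 2 * (f x * i x * i x) + i x * (G x \<bullet> x)" for x
  proof (cases "x \<in> ball 0 1")
    case True
    then have ne: "1 - x \<bullet> x \<noteq> 0" unfolding ball01_iff by simp
    have "(\<Sum>b\<in>Basis. Z b x \<bullet> b) = f x * (\<Sum>b\<in>Basis. H b x \<bullet> b) + i x * (\<Sum>b\<in>Basis. (x \<bullet> b) * (G x \<bullet> b))"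
      by (simp add: Z_def h_def inner_add_left sum.distrib sum_distrib_left algebra_simps)
    also have "(\<Sum>b\<in>Basis. (x \<bullet> b) * (G x \<bullet> b)) = G x \<bullet> x"
      using euclidean_inner[of "G x" x] by (simp add: mult.commute)
    also have "(\<Sum>b\<in>Basis. H b x \<bullet> b) = 2 * (i x)\<^sup>2 * (\<Sum>b\<in>Basis. (x \<bullet> b) * (x \<bullet> b)) + i x * (\<Sum>b\<in>(Basis::(real^2) set). b \<bullet> b)"
      by (simp add: H_def inner_add_left sum.distrib sum_distrib_left algebra_simps)
    also have "(\<Sum>b\<in>Basis. (x \<bullet> b) * (x \<bullet> b)) = x \<bullet> x"
      using euclidean_inner[of x x] by simp
    also have "(\<Sum>b\<in>(Basis::(real^2) set). b \<bullet> b) = 2" by (simp add: Basis_2 axis_12 inner_axis_axis)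
    \<comment> \<open>The divergence of the field collapses only because the dimension is two: i(1 -
      |x|^2) = 1 turns 2 i^2 |x|^2 + 2 i into 2 i^2.\<close>
    also have "2 * (i x)\<^sup>2 * (x \<bullet> x) + i x * 2 = 2 * (i x * i x)"
    proof -
      have "i x * (1 - x \<bullet> x) = 1" using ne by (simp add: i_def)
      then show ?thesis by algebra
    qed
    finally show ?thesis by (simp add: algebra_simps)
  next
    case False
    then show ?thesis using C1_supp_outside[OF f] C1_supp_outside[OF C] by simp
  qed
  have fii: "integrable lborel (\<lambda>x. f x * i x * i x)"
    using C1_supp_integrable(1)[OF C1_supp_inverse_rho[OF C1_supp_inverse_rho[OF f]]] by (simp add: i_def)
  have "integrable lborel (\<lambda>x. \<Sum>b\<in>Basis. Z b x \<bullet> b)"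
    by (intro Bochner_Integration.integrable_sum C1_supp_integrable(2)[OF C])
  then have "integrable lborel (\<lambda>x. 2 * (f x * i x * i x) + i x * (G x \<bullet> x))"
    by (simp only: sumZ)
  from Bochner_Integration.integrable_diff[OF this integrable_mult_right[OF fii, of 2]]
  have iG: "integrable lborel (\<lambda>x. i x * (G x \<bullet> x))"
    by (simp only: add_diff_cancel_left')
  have "(\<integral>x. (\<Sum>b\<in>Basis. Z b x \<bullet> b) \<partial>lborel) = (\<Sum>b\<in>Basis. \<integral>x. Z b x \<bullet> b \<partial>lborel)"
    by (intro Bochner_Integration.integral_sum C1_supp_integrable(2)[OF C])
  also have "\<dots> = 0" by (simp add: integral_GDERIV_zero[OF C])
  finally have "2 * (\<integral>x. f x * i x * i x \<partial>lborel) = - (\<integral>x. i x * (G x \<bullet> x) \<partial>lborel)"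
    using fii iG by (simp add: sumZ)
  then have "ennreal (2 * (\<integral>x. f x * i x * i x \<partial>lborel)) \<le> ennreal (norm (\<integral>x. i x * (G x \<bullet> x) \<partial>lborel))"
    by (intro ennreal_leI) simp
  also have "\<dots> \<le> (\<integral>\<^sup>+x. ennreal (norm (i x * (G x \<bullet> x))) \<partial>lborel)"
    by (rule integral_norm_bound_ennreal[OF iG])
  also have "\<dots> \<le> (\<integral>\<^sup>+x. ennreal (i x) * ennreal (norm (G x)) \<partial>lborel)"
  proof (intro nn_integral_mono)
    fix x
    show "ennreal (norm (i x * (G x \<bullet> x))) \<le> ennreal (i x) * ennreal (norm (G x))"
    proof (cases "x \<in> ball 0 1")
      case True
      then have "0 \<le> i x" unfolding ball01_iff i_def by simp
      moreover have "\<bar>G x \<bullet> x\<bar> \<le> norm (G x)"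
        using Cauchy_Schwarz_ineq2[of "G x" x] True mult_left_le[of "norm x" "norm (G x)"] by simp
      ultimately have "norm (i x * (G x \<bullet> x)) \<le> i x * norm (G x)"
        by (simp add: abs_mult mult_left_mono)
      then show ?thesis using \<open>0 \<le> i x\<close> by (simp add: ennreal_leI flip: ennreal_mult)
    qed (use C1_supp_outside[OF f] in simp)
  qed
  also have "ennreal (2 * (\<integral>x. f x * i x * i x \<partial>lborel)) = 2 * (\<integral>\<^sup>+x. ennreal (f x) \<partial>hyp)"
  proof -
    have "(\<integral>\<^sup>+x. ennreal (f x) \<partial>hyp) = (\<integral>\<^sup>+x. ennreal (f x * i x * i x) \<partial>lborel)"
      unfolding i_def using nonneg
      by (subst nn_integral_hyp) (auto simp: power2_eq_square mult_ac simp flip: ennreal_mult)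
    also have "\<dots> = ennreal (\<integral>x. f x * i x * i x \<partial>lborel)"
      using fii nonneg by (intro nn_integral_eq_integral) (auto simp: mult.assoc)
    finally show ?thesis by (simp add: ennreal_mult')
  qed
  finally show ?thesis by (simp add: i_def)
qed

text \<open>With X and E the two sides, the L1 inequality for the square of \<open>f\<close> and
  Cauchy-Schwarz give X^2 \<le> X E. Dividing by X is legitimate because compact support inside the
  disk makes X finite.\<close>

lemma hardy:
  fixes f :: "real^2 \<Rightarrow> real"
  assumes f: "C1_supp (ball 0 1) f G"
  shows "(\<integral>\<^sup>+x. ennreal ((f x)\<^sup>2) \<partial>hyp) \<le> (\<integral>\<^sup>+x. ennreal ((norm (G x))\<^sup>2) \<partial>lborel)" (is "?X \<le> ?E")
proof -
  note [measurable] = C1_supp_measurable[OF f]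
  define i where "i x = inverse (1 - x \<bullet> x)" for x :: "real^2"
  have [measurable]: "i \<in> borel_measurable borel" unfolding i_def by measurable
  have X: "?X = (\<integral>\<^sup>+x. ennreal ((f x * i x) * (f x * i x)) \<partial>lborel)"
    unfolding i_def by (subst nn_integral_hyp) (auto simp: power2_eq_square mult_ac simp flip: ennreal_mult)
  have "integrable lborel (\<lambda>x. (f x * i x) * (f x * i x))"
    unfolding i_def
    by (rule C1_supp_integrable(1)[OF C1_supp_prod[OF C1_supp_inverse_rho[OF f] C1_supp_inverse_rho[OF f]]])
  then have fin: "?X < \<infinity>"
    unfolding X by (simp add: nn_integral_eq_integral)
  have "2 * ?X \<le> (\<integral>\<^sup>+x. ennreal (i x) * ennreal (norm (f x *\<^sub>R G x + f x *\<^sub>R G x)) \<partial>lborel)"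
    using hardy_L1[OF C1_supp_prod[OF f f]] by (simp add: i_def power2_eq_square)
  also have "\<dots> = (\<integral>\<^sup>+x. 2 * ((ennreal (i x) * ennreal \<bar>f x\<bar>) * ennreal (norm (G x))) \<partial>lborel)"
  proof (intro nn_integral_cong)
    fix x
    have *: "norm (f x *\<^sub>R G x + f x *\<^sub>R G x) = 2 * (\<bar>f x\<bar> * norm (G x))"
      by (simp add: abs_mult flip: scaleR_2)
    show "ennreal (i x) * ennreal (norm (f x *\<^sub>R G x + f x *\<^sub>R G x)) =
        2 * ((ennreal (i x) * ennreal \<bar>f x\<bar>) * ennreal (norm (G x)))"
      unfolding * by (simp add: ennreal_mult mult_ac)
  qed
  also have "\<dots> = 2 * (\<integral>\<^sup>+x. (ennreal (i x) * ennreal \<bar>f x\<bar>) * ennreal (norm (G x)) \<partial>lborel)"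
    by (intro nn_integral_cmult) simp
  finally have "?X \<le> (\<integral>\<^sup>+x. (ennreal (i x) * ennreal \<bar>f x\<bar>) * ennreal (norm (G x)) \<partial>lborel)"
    by (simp add: ennreal_mult_le_mult_iff)
  then have "?X\<^sup>2 \<le> (\<integral>\<^sup>+x. (ennreal (i x) * ennreal \<bar>f x\<bar>) * ennreal (norm (G x)) \<partial>lborel)\<^sup>2"
    by (rule power_mono) simp
  also have "\<dots> \<le> (\<integral>\<^sup>+x. (ennreal (i x) * ennreal \<bar>f x\<bar>)\<^sup>2 \<partial>lborel) * (\<integral>\<^sup>+x. (ennreal (norm (G x)))\<^sup>2 \<partial>lborel)"
    by (rule Cauchy_Schwarz_nn_integral) auto
  also have "(\<integral>\<^sup>+x. (ennreal (norm (G x)))\<^sup>2 \<partial>lborel) = ?E"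
    by (simp add: ennreal_power)
  also have "(\<integral>\<^sup>+x. (ennreal (i x) * ennreal \<bar>f x\<bar>)\<^sup>2 \<partial>lborel) \<le> ?X"
    unfolding X
  proof (intro nn_integral_mono)
    fix x
    show "(ennreal (i x) * ennreal \<bar>f x\<bar>)\<^sup>2 \<le> ennreal (f x * i x * (f x * i x))"
    proof (cases "i x \<ge> 0")
      case True
      then show ?thesis
        by (simp add: ennreal_power power_mult_distrib power2_eq_square[of "_ * _", symmetric] mult.commute flip: ennreal_mult)
    qed (simp add: ennreal_neg)
  qed
  finally have "?X * ?X \<le> ?X * ?E" by (simp add: power2_eq_square mult_right_mono)
  then show ?thesis
    using fin by (cases "?X = 0") (auto simp: ennreal_mult_le_mult_iff)
qed

text \<open>Gagliardo-Nirenberg is applied to f / (1 - |x|^2), whose square integrates over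
  \<open>lborel\<close> as the square of \<open>f\<close> does over \<open>hyp\<close>.
  Differentiating the weight produces 2 f / (1 - |x|^2)^2, which \<open>hardy_L1\<close> bounds by
  the term Y containing the gradient of \<open>f\<close>; hence (Y + Y)^2 and the factor 4.
  Cauchy-Schwarz for Y on \<open>A\<close> brings in the measure of \<open>A\<close>.\<close>

lemma sobolev_hyp:
  fixes f :: "real^2 \<Rightarrow> real"
  assumes f: "C1_supp (ball 0 1) f G" and nonneg: "\<And>x. f x \<ge> 0"
    and [measurable]: "A \<in> sets borel" and A: "\<And>x. x \<notin> A \<Longrightarrow> G x = 0"
  shows "(\<integral>\<^sup>+x. ennreal ((f x)\<^sup>2) \<partial>hyp) \<le> 4 * emeasure hyp A * (\<integral>\<^sup>+x. ennreal ((norm (G x))\<^sup>2) \<partial>lborel)"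
proof -
  note [measurable] = C1_supp_measurable[OF f]
  define i where "i x = inverse (1 - x \<bullet> x)" for x :: "real^2"
  have [measurable]: "i \<in> borel_measurable borel" unfolding i_def by measurable
  define Y where "Y = (\<integral>\<^sup>+x. ennreal (i x) * ennreal (norm (G x)) \<partial>lborel)"
  let ?V = "\<lambda>x. f x *\<^sub>R ((2 * (i x)\<^sup>2) *\<^sub>R x) + i x *\<^sub>R G x"
  have V: "C1_supp (ball 0 1) (\<lambda>x. f x * i x) ?V"
    using C1_supp_inverse_rho[OF f] by (simp add: i_def)
  have "(\<integral>\<^sup>+x. ennreal ((f x)\<^sup>2) \<partial>hyp) = (\<integral>\<^sup>+x. ennreal ((f x * i x)\<^sup>2) \<partial>lborel)"
    unfolding i_def by (subst nn_integral_hyp) (auto simp: power_mult_distrib mult_ac simp flip: ennreal_mult)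
  also have "\<dots> \<le> (\<integral>\<^sup>+x. ennreal (norm (?V x)) \<partial>lborel)\<^sup>2"
    by (rule gagliardo_nirenberg[OF V])
  finally have 1: "(\<integral>\<^sup>+x. ennreal ((f x)\<^sup>2) \<partial>hyp) \<le> (\<integral>\<^sup>+x. ennreal (norm (?V x)) \<partial>lborel)\<^sup>2" .
  have "(\<integral>\<^sup>+x. ennreal (norm (?V x)) \<partial>lborel) \<le>
     (\<integral>\<^sup>+x. 2 * (ennreal ((i x)\<^sup>2) * ennreal (f x)) + ennreal (i x) * ennreal (norm (G x)) \<partial>lborel)"
  proof (intro nn_integral_mono)
    fix x
    show "ennreal (norm (?V x)) \<le> 2 * (ennreal ((i x)\<^sup>2) * ennreal (f x)) + ennreal (i x) * ennreal (norm (G x))"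
    proof (cases "x \<in> ball 0 1")
      case True
      then have i: "0 \<le> i x" unfolding ball01_iff i_def by simp
      have "norm (?V x) \<le> norm (f x *\<^sub>R ((2 * (i x)\<^sup>2) *\<^sub>R x)) + norm (i x *\<^sub>R G x)"
        by (rule norm_triangle_ineq)
      also have "\<dots> \<le> 2 * ((i x)\<^sup>2 * f x) + i x * norm (G x)"
        using True i nonneg[of x] mult_left_le[of "norm x" "(i x)\<^sup>2 * f x"] by (simp add: abs_mult mult_ac)
      finally have "ennreal (norm (?V x)) \<le> ennreal (2 * ((i x)\<^sup>2 * f x) + i x * norm (G x))"
        by (rule ennreal_leI)
      also have "\<dots> = 2 * (ennreal ((i x)\<^sup>2) * ennreal (f x)) + ennreal (i x) * ennreal (norm (G x))"
        using i nonneg[of x] by (simp add: ennreal_plus ennreal_mult)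
      finally show ?thesis .
    qed (use C1_supp_outside[OF f] in simp)
  qed
  also have "\<dots> = 2 * (\<integral>\<^sup>+x. ennreal (f x) \<partial>hyp) + Y"
    by (simp add: nn_integral_add nn_integral_cmult nn_integral_hyp Y_def i_def)
  also have "\<dots> \<le> Y + Y"
    using hardy_L1[OF f nonneg] by (intro add_mono) (auto simp: Y_def i_def)
  finally have "(\<integral>\<^sup>+x. ennreal ((f x)\<^sup>2) \<partial>hyp) \<le> (Y + Y)\<^sup>2"
    by (intro order_trans[OF 1] power_mono) auto
  then have 2: "(\<integral>\<^sup>+x. ennreal ((f x)\<^sup>2) \<partial>hyp) \<le> 4 * Y\<^sup>2"
    by (simp add: power2_eq_square mult_ac flip: mult_2)
  have "Y = (\<integral>\<^sup>+x. (ennreal (i x) * indicator A x) * ennreal (norm (G x)) \<partial>lborel)"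
    unfolding Y_def using A by (intro nn_integral_cong) (auto simp: indicator_def)
  then have "Y\<^sup>2 \<le> (\<integral>\<^sup>+x. (ennreal (i x) * indicator A x)\<^sup>2 \<partial>lborel) * (\<integral>\<^sup>+x. (ennreal (norm (G x)))\<^sup>2 \<partial>lborel)"
    by (simp add: Cauchy_Schwarz_nn_integral)
  also have "(\<integral>\<^sup>+x. (ennreal (i x) * indicator A x)\<^sup>2 \<partial>lborel) \<le> (\<integral>\<^sup>+x. ennreal ((i x)\<^sup>2) * indicator A x \<partial>lborel)"
  proof (intro nn_integral_mono)
    fix x
    show "(ennreal (i x) * indicator A x)\<^sup>2 \<le> ennreal ((i x)\<^sup>2) * indicator A x"
      by (cases "i x \<ge> 0") (auto simp: indicator_def ennreal_power ennreal_neg)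
  qed
  also have "\<dots> = emeasure hyp A"
    unfolding hyp_def by (subst emeasure_density) (auto simp: i_def)
  finally have "Y\<^sup>2 \<le> emeasure hyp A * (\<integral>\<^sup>+x. ennreal ((norm (G x))\<^sup>2) \<partial>lborel)"
    by (simp add: ennreal_power mult_right_mono)
  then show ?thesis
    using order_trans[OF 2 mult_left_mono[of "Y\<^sup>2" _ 4]] by (simp add: mult.assoc)
qed

subsection \<open>Trudinger inequality\<close>

text \<open>A C1 transition from \<open>0\<close> to \<open>1\<close>, obtained by iterating the C1 function \<open>x \<mapsto> (max 0 x)\<^sup>2\<close>.\<close>

definition ramp :: "real \<Rightarrow> real" where
  "ramp x = (max 0 (1 - (max 0 (1 - x))\<^sup>2))\<^sup>2"

definition ramp' :: "real \<Rightarrow> real" where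
  "ramp' x = (2 * max 0 (1 - (max 0 (1 - x))\<^sup>2)) * (2 * max 0 (1 - x))"

lemma DERIV_pos_part_square: "((\<lambda>x. (max 0 x)\<^sup>2) has_real_derivative 2 * max 0 x) (at (x::real))"
proof -
  consider "x < 0" | "x = 0" | "x > 0" by linarith
  then show ?thesis
  proof cases
    case 1
    have "((\<lambda>_. 0) has_real_derivative 0) (at x)" by simp
    then have "((\<lambda>x. (max 0 x)\<^sup>2) has_real_derivative 0) (at x)"
      by (rule DERIV_cong_ev[THEN iffD1, rotated -1])
         (use 1 eventually_nhds_in_open[of "{..<0}" x] in \<open>auto elim!: eventually_mono\<close>)
    with 1 show ?thesis by simp
  next
    case 2
    have "((\<lambda>h::real. max 0 h) \<longlongrightarrow> max 0 0) (at 0)" by (intro tendsto_intros)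
    moreover have "\<forall>\<^sub>F h::real in at 0. max 0 h = (max 0 h)\<^sup>2 / h"
      unfolding eventually_at_filter
      by (intro always_eventually) (auto simp: max_def power2_eq_square)
    ultimately have "((\<lambda>h::real. (max 0 h)\<^sup>2 / h) \<longlongrightarrow> 0) (at 0)"
      using tendsto_cong by fastforce
    then show ?thesis using 2 by (simp add: DERIV_def)
  next
    case 3
    have "((\<lambda>x. x\<^sup>2) has_real_derivative 2 * x) (at x)"
      by (auto intro!: derivative_eq_intros)
    then have "((\<lambda>x. (max 0 x)\<^sup>2) has_real_derivative 2 * x) (at x)"
      by (rule DERIV_cong_ev[THEN iffD1, rotated -1])
         (use 3 eventually_nhds_in_open[of "{0<..}" x] in \<open>auto elim!: eventually_mono\<close>)
    with 3 show ?thesis by simp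
  qed
qed

lemma DERIV_ramp: "(ramp has_real_derivative ramp' x) (at x)"
proof -
  have "((\<lambda>x. 1 - x) has_real_derivative -1) (at x)"
    by (auto intro!: derivative_eq_intros)
  from DERIV_chain2[OF DERIV_pos_part_square this]
  have "((\<lambda>x. 1 - (max 0 (1 - x))\<^sup>2) has_real_derivative (2 * max 0 (1 - x))) (at x)"
    using DERIV_diff[OF DERIV_const[of 1]] by fastforce
  from DERIV_chain2[OF DERIV_pos_part_square this]
  show ?thesis unfolding ramp_def[abs_def] ramp'_def by simp
qed

lemma ramp_props:
  "x \<le> 0 \<Longrightarrow> ramp x = 0" "x \<ge> 1 \<Longrightarrow> ramp x = 1" "0 \<le> ramp x"
  "x \<le> 0 \<or> x \<ge> 1 \<Longrightarrow> ramp' x = 0" "0 \<le> ramp' x" "ramp' x \<le> 4" "continuous_on UNIV ramp'"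
proof -
  have *: "1 - (max 0 (1 - x))\<^sup>2 \<le> 0" if "x \<le> 0"
    using that one_le_power[of "1 - x" 2] by simp
  show "x \<le> 0 \<Longrightarrow> ramp x = 0" using * by (simp add: ramp_def max_absorb1)
  show "x \<le> 0 \<or> x \<ge> 1 \<Longrightarrow> ramp' x = 0" using * by (auto simp: ramp'_def max_absorb1)
  show "x \<ge> 1 \<Longrightarrow> ramp x = 1" "0 \<le> ramp x" "0 \<le> ramp' x" by (auto simp: ramp_def ramp'_def)
  show "ramp' x \<le> 4"
  proof (cases "x \<le> 0")
    case True
    then show ?thesis using * by (simp add: ramp'_def max_absorb1)
  next
    case False
    then have "ramp' x \<le> 2 * 2" unfolding ramp'_def by (intro mult_mono) auto
    then show ?thesis by simp
  qed
  show "continuous_on UNIV ramp'" unfolding ramp'_def[abs_def] by (intro continuous_intros)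
qed

text \<open>Truncating in the square of \<open>w\<close> treats both signs at once and is smooth
  across the zeros of \<open>w\<close>. The factor 8 b / (b^2 - a^2) is the slope bound 4 of
  \<open>ramp\<close> times the derivative 2|y| / (b^2 - a^2) on the shell, where |y| \<le>
  b.\<close>

lemma level_truncation:
  assumes w: "C1_supp U w W" and ab: "0 \<le> a" "a < b"
  obtains T G where "C1_supp U T G" "\<And>x. 0 \<le> T x" "\<And>x. b\<^sup>2 \<le> (w x)\<^sup>2 \<Longrightarrow> T x = 1"
    "\<And>x. norm (G x) \<le> (8 * b / (b\<^sup>2 - a\<^sup>2)) * (norm (W x) * indicator {x. a\<^sup>2 < (w x)\<^sup>2 \<and> (w x)\<^sup>2 < b\<^sup>2} x)"
proof -
  define d where "d = b\<^sup>2 - a\<^sup>2"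
  have d: "d > 0" using ab power_strict_mono[of a b 2] by (simp add: d_def)
  define h where "h y = ramp ((y\<^sup>2 - a\<^sup>2) / d)" for y
  define h' where "h' y = ramp' ((y\<^sup>2 - a\<^sup>2) / d) * (2 * y / d)" for y
  have inner: "((\<lambda>y. (y\<^sup>2 - a\<^sup>2) / d) has_real_derivative 2 * y / d) (at y)" for y
    using d by (auto intro!: derivative_eq_intros)
  have h: "(h has_real_derivative h' y) (at y)" for y
    using DERIV_chain2[OF DERIV_ramp inner] unfolding h_def[abs_def] h'_def .
  have h': "continuous_on UNIV h'"
    unfolding h'_def[abs_def] using d
    by (intro continuous_intros continuous_on_compose2[OF ramp_props(7)]) auto
  have "h 0 = 0" using d ramp_props(1)[of "- a\<^sup>2 / d"] by (simp add: h_def)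
  from C1_supp_compose[OF w h h' this]
  have C: "C1_supp U (\<lambda>x. h (w x)) (\<lambda>x. h' (w x) *\<^sub>R W x)" .
  show thesis
  proof (rule that[OF C])
    show "0 \<le> h (w x)" for x by (simp add: h_def ramp_props)
    show "h (w x) = 1" if "b\<^sup>2 \<le> (w x)\<^sup>2" for x
      using that d by (auto simp: h_def d_def intro!: ramp_props)
    fix x
    show "norm (h' (w x) *\<^sub>R W x) \<le> (8 * b / (b\<^sup>2 - a\<^sup>2)) * (norm (W x) * indicator {x. a\<^sup>2 < (w x)\<^sup>2 \<and> (w x)\<^sup>2 < b\<^sup>2} x)"
    proof (cases "a\<^sup>2 < (w x)\<^sup>2 \<and> (w x)\<^sup>2 < b\<^sup>2")
      case True
      then have "\<bar>w x\<bar> \<le> b" using ab by (metis abs_le_square_iff abs_of_nonneg less_imp_le order_trans)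
      have "\<bar>h' (w x)\<bar> = ramp' (((w x)\<^sup>2 - a\<^sup>2) / d) * (2 * \<bar>w x\<bar> / d)"
        using d by (simp add: h'_def abs_mult ramp_props)
      also have "\<dots> \<le> 4 * (2 * b / d)"
        using \<open>\<bar>w x\<bar> \<le> b\<close> d by (intro mult_mono ramp_props divide_right_mono) auto
      finally have "\<bar>h' (w x)\<bar> * norm (W x) \<le> 4 * (2 * b / d) * norm (W x)"
        by (rule mult_right_mono) simp
      then show ?thesis using True by (simp add: d_def)
    next
      case False
      then have "((w x)\<^sup>2 - a\<^sup>2) / d \<le> 0 \<or> ((w x)\<^sup>2 - a\<^sup>2) / d \<ge> 1"
        using d by (auto simp: d_def divide_simps)
      then have "h' (w x) = 0" by (simp add: h'_def ramp_props)
      then show ?thesis using ab d by (simp add: d_def)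
    qed
  qed
qed

text \<open>The truncation is 1 on the upper level set, so the hyperbolic integral of its square
  bounds the measure of that set. Hardy gives a bound by energy alone, which can start the chain;
  Sobolev also gains the measure of the lower level set, which carries it on. The strict
  inequalities in \<open>E\<close> keep the shells of successive levels disjoint.\<close>

lemma level_step:
  fixes w :: "real^2 \<Rightarrow> real"
  assumes w: "C1_supp (ball 0 1) w W" and ab: "0 \<le> a" "a < b" and c: "8 * b / (b\<^sup>2 - a\<^sup>2) \<le> c"
  defines "E \<equiv> (\<integral>\<^sup>+x. ennreal ((norm (W x))\<^sup>2) * indicator {x. a\<^sup>2 < (w x)\<^sup>2 \<and> (w x)\<^sup>2 < b\<^sup>2} x \<partial>lborel)"
  shows "emeasure hyp {x. b\<^sup>2 \<le> (w x)\<^sup>2} \<le> ennreal (c\<^sup>2) * E"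
    and "emeasure hyp {x. b\<^sup>2 \<le> (w x)\<^sup>2} \<le> 4 * emeasure hyp {x. a\<^sup>2 \<le> (w x)\<^sup>2} * (ennreal (c\<^sup>2) * E)"
proof -
  obtain T G where T: "C1_supp (ball 0 1) T G" "\<And>x. 0 \<le> T x" "\<And>x. b\<^sup>2 \<le> (w x)\<^sup>2 \<Longrightarrow> T x = 1"
    and G: "\<And>x. norm (G x) \<le> (8 * b / (b\<^sup>2 - a\<^sup>2)) * (norm (W x) * indicator {x. a\<^sup>2 < (w x)\<^sup>2 \<and> (w x)\<^sup>2 < b\<^sup>2} x)"
    by (rule level_truncation[OF w ab], rule that)
  note [measurable] = C1_supp_measurable[OF w] C1_supp_measurable[OF T(1)]
  have GE: "(\<integral>\<^sup>+x. ennreal ((norm (G x))\<^sup>2) \<partial>lborel) \<le> ennreal (c\<^sup>2) * E"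
  proof -
    have "(\<integral>\<^sup>+x. ennreal ((norm (G x))\<^sup>2) \<partial>lborel) \<le>
       (\<integral>\<^sup>+x. ennreal (c\<^sup>2) * (ennreal ((norm (W x))\<^sup>2) * indicator {x. a\<^sup>2 < (w x)\<^sup>2 \<and> (w x)\<^sup>2 < b\<^sup>2} x) \<partial>lborel)"
    proof (intro nn_integral_mono)
      fix x
      have "norm (G x) \<le> c * (norm (W x) * indicator {x. a\<^sup>2 < (w x)\<^sup>2 \<and> (w x)\<^sup>2 < b\<^sup>2} x)"
        using order_trans[OF G mult_right_mono[OF c]] by simp
      then have "(norm (G x))\<^sup>2 \<le> (c * (norm (W x) * indicator {x. a\<^sup>2 < (w x)\<^sup>2 \<and> (w x)\<^sup>2 < b\<^sup>2} x))\<^sup>2"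
        by (intro power_mono) auto
      also have "\<dots> = c\<^sup>2 * ((norm (W x))\<^sup>2 * indicator {x. a\<^sup>2 < (w x)\<^sup>2 \<and> (w x)\<^sup>2 < b\<^sup>2} x)"
        by (simp add: power_mult_distrib indicator_def)
      finally have "ennreal ((norm (G x))\<^sup>2) \<le> ennreal (c\<^sup>2 * ((norm (W x))\<^sup>2 * indicator {x. a\<^sup>2 < (w x)\<^sup>2 \<and> (w x)\<^sup>2 < b\<^sup>2} x))"
        by (rule ennreal_leI)
      then show "ennreal ((norm (G x))\<^sup>2) \<le> ennreal (c\<^sup>2) * (ennreal ((norm (W x))\<^sup>2) * indicator {x. a\<^sup>2 < (w x)\<^sup>2 \<and> (w x)\<^sup>2 < b\<^sup>2} x)"
        by (simp add: ennreal_mult ennreal_indicator)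
    qed
    also have "\<dots> = ennreal (c\<^sup>2) * E"
      unfolding E_def by (rule nn_integral_cmult) simp
    finally show ?thesis .
  qed
  have "emeasure hyp {x. b\<^sup>2 \<le> (w x)\<^sup>2} = (\<integral>\<^sup>+x. indicator {x. b\<^sup>2 \<le> (w x)\<^sup>2} x \<partial>hyp)"
    by (intro nn_integral_indicator[symmetric]) simp
  also have "\<dots> \<le> (\<integral>\<^sup>+x. ennreal ((T x)\<^sup>2) \<partial>hyp)"
    by (intro nn_integral_mono) (auto simp: indicator_def T(3))
  finally have le: "emeasure hyp {x. b\<^sup>2 \<le> (w x)\<^sup>2} \<le> (\<integral>\<^sup>+x. ennreal ((T x)\<^sup>2) \<partial>hyp)" .
  show "emeasure hyp {x. b\<^sup>2 \<le> (w x)\<^sup>2} \<le> ennreal (c\<^sup>2) * E"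
    using le hardy[OF T(1)] GE by (meson order_trans)
  have "G x = 0" if "x \<notin> {x. a\<^sup>2 \<le> (w x)\<^sup>2}" for x
    using G[of x] that by (auto simp: indicator_def)
  then have "(\<integral>\<^sup>+x. ennreal ((T x)\<^sup>2) \<partial>hyp) \<le> 4 * emeasure hyp {x. a\<^sup>2 \<le> (w x)\<^sup>2} * (\<integral>\<^sup>+x. ennreal ((norm (G x))\<^sup>2) \<partial>lborel)"
    by (intro sobolev_hyp[OF T(1) T(2)]) auto
  also have "\<dots> \<le> 4 * emeasure hyp {x. a\<^sup>2 \<le> (w x)\<^sup>2} * (ennreal (c\<^sup>2) * E)"
    by (intro mult_left_mono GE) auto
  finally show "emeasure hyp {x. b\<^sup>2 \<le> (w x)\<^sup>2} \<le> 4 * emeasure hyp {x. a\<^sup>2 \<le> (w x)\<^sup>2} * (ennreal (c\<^sup>2) * E)"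
    using le by (rule order_trans[rotated])
qed

text \<open>The root-free form of the arithmetic-geometric mean inequality. A vanishing product is
  treated apart because the root is taken with \<open>powr\<close>.\<close>

lemma prod_le_mean_power:
  fixes x :: "'a \<Rightarrow> real"
  assumes "finite S" "S \<noteq> {}" "\<And>i. i \<in> S \<Longrightarrow> x i \<ge> 0"
  shows "(\<Prod>i\<in>S. x i) \<le> ((\<Sum>i\<in>S. x i) / card S) ^ card S"
proof -
  let ?P = "\<Prod>i\<in>S. x i" and ?m = "(\<Sum>i\<in>S. x i) / card S"
  have P: "?P \<ge> 0" using assms by (intro prod_nonneg) auto
  have c: "card S > 0" using assms by (simp add: card_gt_0_iff)
  have m: "?m \<ge> 0" using assms by (intro divide_nonneg_nonneg sum_nonneg) auto
  show ?thesis
  proof (cases "?P = 0")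
    case False
    then have "?P = (?P powr (1 / card S)) ^ card S"
      using P c by (simp add: powr_powr flip: powr_realpow)
    also have "\<dots> \<le> ?m ^ card S"
      using arith_geom_mean[OF assms] by (intro power_mono) (auto simp: sum_divide_distrib)
    finally show ?thesis .
  qed (use m in simp)
qed

text \<open>Each of the n^2 steps contributes 4 * (8 n)^2 = 256 n^2 times the energy of its shell.
  The shells are disjoint, so these energies sum to at most \<open>e\<close> and have mean at most e
  / n^2; passing from the product to the mean cancels the n^2 and leaves 256 e in every
  factor.\<close>

lemma level_decay:
  fixes w :: "real^2 \<Rightarrow> real" and n :: nat
  assumes w: "C1_supp (ball 0 1) w W" and n: "n > 0"
    and E: "(\<integral>\<^sup>+x. ennreal ((norm (W x))\<^sup>2) \<partial>lborel) \<le> ennreal e" and e: "e \<ge> 0"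
  shows "emeasure hyp {x. (real n)\<^sup>2 \<le> (w x)\<^sup>2} \<le> ennreal ((256 * e) ^ n\<^sup>2)"
proof -
  note [measurable] = C1_supp_measurable[OF w]
  define A where "A j = {x. (real j / n)\<^sup>2 < (w x)\<^sup>2 \<and> (w x)\<^sup>2 < (real (Suc j) / n)\<^sup>2}" for j
  have [measurable]: "A j \<in> sets borel" for j unfolding A_def by measurable
  define F where "F j = (\<integral>\<^sup>+x. ennreal ((norm (W x))\<^sup>2) * indicator (A j) x \<partial>lborel)" for j
  have disj: "j = k" if "x \<in> A j" "x \<in> A k" for x j k
  proof -
    have *: "j < Suc k" if "(real j / n)\<^sup>2 < (w x)\<^sup>2" "(w x)\<^sup>2 < (real (Suc k) / n)\<^sup>2" for j k
    proof -
      have "(real j / n)\<^sup>2 < (real (Suc k) / n)\<^sup>2" using that by linarith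
      then have "real j / n < real (Suc k) / n"
        by (rule power_less_imp_less_base) simp
      then show ?thesis using n by (simp add: divide_less_cancel)
    qed
    show ?thesis using *[of j k] *[of k j] that by (force simp: A_def)
  qed
  have sumF: "(\<Sum>j<m. F j) \<le> ennreal e" for m
  proof -
    have "(\<Sum>j<m. F j) = (\<integral>\<^sup>+x. (\<Sum>j<m. ennreal ((norm (W x))\<^sup>2) * indicator (A j) x) \<partial>lborel)"
      unfolding F_def by (rule nn_integral_sum[symmetric]) simp
    also have "\<dots> \<le> (\<integral>\<^sup>+x. ennreal ((norm (W x))\<^sup>2) \<partial>lborel)"
    proof (intro nn_integral_mono)
      fix x
      have "(\<Sum>j<m. indicator (A j) x :: ennreal) \<le> 1"
      proof (cases "\<exists>j<m. x \<in> A j")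
        case True
        then obtain j where j: "j < m" "x \<in> A j" by auto
        then have "(\<Sum>k<m. indicator (A k) x :: ennreal) = (\<Sum>k<m. if k = j then 1 else 0)"
          using disj by (intro sum.cong) (auto simp: indicator_def)
        then show ?thesis using j by simp
      next
        case False
        then have "(\<Sum>k<m. indicator (A k) x :: ennreal) = 0"
          by (intro sum.neutral) auto
        then show ?thesis by simp
      qed
      then show "(\<Sum>j<m. ennreal ((norm (W x))\<^sup>2) * indicator (A j) x) \<le> ennreal ((norm (W x))\<^sup>2)"
        using mult_left_mono[of "\<Sum>j<m. indicator (A j) x" 1 "ennreal ((norm (W x))\<^sup>2)"]
        by (simp add: sum_distrib_left)
    qed
    finally show ?thesis using E by (rule order_trans)
  qed
  have step: "emeasure hyp {x. (real (Suc j) / n)\<^sup>2 \<le> (w x)\<^sup>2} \<le> ennreal ((8 * real n)\<^sup>2) * F j"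
    "emeasure hyp {x. (real (Suc j) / n)\<^sup>2 \<le> (w x)\<^sup>2} \<le>
       4 * emeasure hyp {x. (real j / n)\<^sup>2 \<le> (w x)\<^sup>2} * (ennreal ((8 * real n)\<^sup>2) * F j)" for j
  proof -
    \<comment> \<open>The slope factor is 8 n (j + 1) / (2 j + 1), which is at most 8 n for every
      \<open>j\<close>: one constant serves all levels.\<close>
    have "(real (Suc j) / n)\<^sup>2 - (real j / n)\<^sup>2 = (2 * real j + 1) / (real n)\<^sup>2"
      using n by (simp add: field_simps power2_eq_square)
    then have c: "8 * (real (Suc j) / n) / ((real (Suc j) / n)\<^sup>2 - (real j / n)\<^sup>2) \<le> 8 * real n"
      using n by (simp add: divide_simps power2_eq_square)
    have ab: "0 \<le> real j / n" "real j / n < real (Suc j) / n" using n by (auto simp: divide_simps)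
    show "emeasure hyp {x. (real (Suc j) / n)\<^sup>2 \<le> (w x)\<^sup>2} \<le> ennreal ((8 * real n)\<^sup>2) * F j"
      "emeasure hyp {x. (real (Suc j) / n)\<^sup>2 \<le> (w x)\<^sup>2} \<le>
       4 * emeasure hyp {x. (real j / n)\<^sup>2 \<le> (w x)\<^sup>2} * (ennreal ((8 * real n)\<^sup>2) * F j)"
      using level_step[OF w ab c] unfolding F_def A_def by auto
  qed
  define f where "f j = enn2real (F j)" for j
  have f: "F j = ennreal (f j)" "0 \<le> f j" for j
  proof -
    have "F j \<le> (\<Sum>j<Suc j. F j)" by (simp add: add_increasing)
    then have "F j < \<infinity>" using sumF[of "Suc j"] ennreal_less_top[of e] by (metis infinity_ennreal_def le_less_trans)
    then show "F j = ennreal (f j)" "0 \<le> f j" by (auto simp: f_def)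
  qed
  have sumf: "(\<Sum>j<m. f j) \<le> e" for m
    using sumF[of m] e by (simp add: f sum_ennreal)
  have prod: "emeasure hyp {x. (real (Suc m) / n)\<^sup>2 \<le> (w x)\<^sup>2} \<le> ennreal (\<Prod>j<Suc m. 256 * (real n)\<^sup>2 * f j)" for m
  proof (induction m)
    \<comment> \<open>The first step must use the Hardy bound: the lower level set at height 0 is
      the whole plane, of infinite \<open>hyp\<close> measure.\<close>
    case 0
    have "emeasure hyp {x. (real (Suc 0) / n)\<^sup>2 \<le> (w x)\<^sup>2} \<le> ennreal ((8 * real n)\<^sup>2 * f 0)"
      using step(1)[of 0] f by (simp add: ennreal_mult)
    also have "\<dots> \<le> ennreal (256 * (real n)\<^sup>2 * f 0)"
      using f by (intro ennreal_leI mult_right_mono) (auto simp: power2_eq_square)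
    finally show ?case by simp
  next
    case (Suc m)
    have "emeasure hyp {x. (real (Suc (Suc m)) / n)\<^sup>2 \<le> (w x)\<^sup>2} \<le>
       4 * emeasure hyp {x. (real (Suc m) / n)\<^sup>2 \<le> (w x)\<^sup>2} * (ennreal ((8 * real n)\<^sup>2) * F (Suc m))"
      by (rule step)
    also have "\<dots> \<le> 4 * ennreal (\<Prod>j<Suc m. 256 * (real n)\<^sup>2 * f j) * (ennreal ((8 * real n)\<^sup>2) * F (Suc m))"
      by (intro mult_left_mono mult_right_mono Suc.IH) auto
    also have "\<dots> = ennreal (4 * (\<Prod>j<Suc m. 256 * (real n)\<^sup>2 * f j) * ((8 * real n)\<^sup>2 * f (Suc m)))"
    proof -
      have "0 \<le> (\<Prod>j<Suc m. 256 * (real n)\<^sup>2 * f j)" using f by (intro prod_nonneg) auto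
      then show ?thesis using f by (simp only: f ennreal_mult' ennreal_mult'' zero_le_power2 mult_nonneg_nonneg) (simp add: ennreal_mult)
    qed
    also have "4 * (\<Prod>j<Suc m. 256 * (real n)\<^sup>2 * f j) * ((8 * real n)\<^sup>2 * f (Suc m)) = (\<Prod>j<Suc (Suc m). 256 * (real n)\<^sup>2 * f j)"
      by (simp add: power2_eq_square)
    finally show ?case .
  qed
  \<comment> \<open>After n^2 steps of width 1/n the height reached is \<open>n\<close>.\<close>
  obtain m where m: "n\<^sup>2 = Suc m" using n by (metis gr0_implies_Suc zero_less_power)
  have "real (n\<^sup>2) / n = real n" using n by (simp add: power2_eq_square)
  then have "emeasure hyp {x. (real n)\<^sup>2 \<le> (w x)\<^sup>2} \<le> ennreal (\<Prod>j<n\<^sup>2. 256 * (real n)\<^sup>2 * f j)"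
    using prod[of m] unfolding m[symmetric] by simp
  also have "\<dots> \<le> ennreal ((256 * e) ^ n\<^sup>2)"
  proof (rule ennreal_leI)
    have "(\<Prod>j<n\<^sup>2. 256 * (real n)\<^sup>2 * f j) \<le> ((\<Sum>j<n\<^sup>2. 256 * (real n)\<^sup>2 * f j) / card {..<n\<^sup>2}) ^ card {..<n\<^sup>2}"
      using n f by (intro prod_le_mean_power) (auto simp: lessThan_empty_iff)
    also have "\<dots> = (256 * (\<Sum>j<n\<^sup>2. f j)) ^ n\<^sup>2"
      using n by (simp add: sum_distrib_left[symmetric])
    also have "\<dots> \<le> (256 * e) ^ n\<^sup>2"
      using sumf f by (intro power_mono mult_left_mono mult_nonneg_nonneg sum_nonneg) auto
    finally show "(\<Prod>j<n\<^sup>2. 256 * (real n)\<^sup>2 * f j) \<le> (256 * e) ^ n\<^sup>2" .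
  qed
  finally show ?thesis .
qed

text \<open>Small and large values are separated at |s| = 1. Below, exp t - 1 \<le> t exp t gives a
  multiple of s^2, integrable by Hardy although the set of small values may have infinite measure.
  Above, the single layer that contains |s| already dominates, and it is one term of the
  series.\<close>

lemma exp_levels_bound:
  fixes s \<alpha> :: real
  assumes "\<alpha> \<ge> 0"
  shows "ennreal (exp (\<alpha> * s\<^sup>2) - 1) \<le> ennreal (\<alpha> * exp \<alpha>) * ennreal (s\<^sup>2) +
    (\<Sum>n. ennreal (exp (\<alpha> * (real (Suc (Suc n)))\<^sup>2)) * indicator {s. (real (Suc n))\<^sup>2 \<le> s\<^sup>2} s)"
proof (cases "\<bar>s\<bar> < 1")
  case True
  define t where "t = \<alpha> * s\<^sup>2"
  have "s\<^sup>2 \<le> 1" using True by (simp add: abs_square_le_1)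
  then have t: "0 \<le> t" "t \<le> \<alpha>" using assms mult_left_le[of "s\<^sup>2" \<alpha>] by (auto simp: t_def)
  have "exp t * (1 - t) \<le> exp t * exp (- t)"
    using exp_ge_add_one_self[of "- t"] by (intro mult_left_mono) auto
  then have "exp t - 1 \<le> t * exp t" by (simp add: algebra_simps flip: exp_add)
  also have "\<dots> \<le> t * exp \<alpha>" using t by (intro mult_left_mono) auto
  finally have "ennreal (exp (\<alpha> * s\<^sup>2) - 1) \<le> ennreal (\<alpha> * exp \<alpha> * s\<^sup>2)"
    by (intro ennreal_leI) (simp add: t_def mult_ac)
  also have "\<dots> = ennreal (\<alpha> * exp \<alpha>) * ennreal (s\<^sup>2)"
    using assms by (simp add: ennreal_mult)
  finally show ?thesis by (simp add: add_increasing2)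
next
  case False
  \<comment> \<open>Shifted so that \<open>Suc n\<close> is the integer part of |s|, which is at
    least 1 here.\<close>
  define n where "n = nat \<lfloor>\<bar>s\<bar>\<rfloor> - 1"
  have n: "real (Suc n) \<le> \<bar>s\<bar>" "\<bar>s\<bar> \<le> real (Suc (Suc n))" using False by (auto simp: n_def) linarith+
  have 1: "(real (Suc n))\<^sup>2 \<le> s\<^sup>2" using n(1) by (metis abs_le_square_iff abs_of_nat)
  have 2: "s\<^sup>2 \<le> (real (Suc (Suc n)))\<^sup>2" using n(2) by (metis abs_le_square_iff abs_of_nat)
  have "ennreal (exp (\<alpha> * s\<^sup>2) - 1) \<le> ennreal (exp (\<alpha> * (real (Suc (Suc n)))\<^sup>2))"
    using mult_left_mono[OF 2 assms] by (intro ennreal_leI) (smt (verit) exp_le_cancel_iff)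
  also have "\<dots> = (\<Sum>k\<in>{n}. ennreal (exp (\<alpha> * (real (Suc (Suc k)))\<^sup>2)) * indicator {s. (real (Suc k))\<^sup>2 \<le> s\<^sup>2} s)"
    using 1 by simp
  also have "\<dots> \<le> (\<Sum>n. ennreal (exp (\<alpha> * (real (Suc (Suc n)))\<^sup>2)) * indicator {s. (real (Suc n))\<^sup>2 \<le> s\<^sup>2} s)"
    by (rule sum_le_suminf) auto
  finally show ?thesis by (simp add: add_increasing)
qed

text \<open>The threshold \<epsilon> may shrink with \<alpha>: it is chosen so that the decay of the
  level sets beats the exponential growth. \<open>C\<close> must not depend on \<open>w\<close>,
  because the bound is later passed through a limit.\<close>

lemma trudinger:
  fixes \<alpha> :: real
  assumes \<alpha>: "\<alpha> \<ge> 0"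
  obtains \<epsilon> C where "\<epsilon> > 0"
    "\<And>w W. C1_supp (ball 0 1) (w :: real^2 \<Rightarrow> real) W \<Longrightarrow> (\<integral>\<^sup>+x. ennreal ((norm (W x))\<^sup>2) \<partial>lborel) \<le> ennreal \<epsilon> \<Longrightarrow>
       (\<integral>\<^sup>+x. ennreal (exp (\<alpha> * (w x)\<^sup>2) - 1) \<partial>hyp) \<le> ennreal C"
proof
  \<comment> \<open>Since (m + 1)^2 \<le> 4 m^2 for m \<ge> 1, the exponential on layer m is at most
    exp(4 \<alpha>) to the power m^2. With 256 \<epsilon> = 1 / (2 exp(4 \<alpha>)) the layer
    contributes at most (1/2)^(m^2).\<close>
  define \<epsilon> where "\<epsilon> = 1 / (512 * exp (4 * \<alpha>))"
  show eps: "\<epsilon> > 0" by (simp add: \<epsilon>_def)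
  fix w :: "real^2 \<Rightarrow> real" and W
  assume w: "C1_supp (ball 0 1) w W" and E: "(\<integral>\<^sup>+x. ennreal ((norm (W x))\<^sup>2) \<partial>lborel) \<le> ennreal \<epsilon>"
  note [measurable] = C1_supp_measurable[OF w]
  have "(\<integral>\<^sup>+x. ennreal (exp (\<alpha> * (w x)\<^sup>2) - 1) \<partial>hyp) \<le> (\<integral>\<^sup>+x. (ennreal (\<alpha> * exp \<alpha>) * ennreal ((w x)\<^sup>2) +
    (\<Sum>n. ennreal (exp (\<alpha> * (real (Suc (Suc n)))\<^sup>2)) * indicator {s. (real (Suc n))\<^sup>2 \<le> s\<^sup>2} (w x))) \<partial>hyp)"
    by (intro nn_integral_mono exp_levels_bound \<alpha>)
  also have "\<dots> = ennreal (\<alpha> * exp \<alpha>) * (\<integral>\<^sup>+x. ennreal ((w x)\<^sup>2) \<partial>hyp) +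
      (\<Sum>n. ennreal (exp (\<alpha> * (real (Suc (Suc n)))\<^sup>2)) * (\<integral>\<^sup>+x. indicator {s. (real (Suc n))\<^sup>2 \<le> s\<^sup>2} (w x) \<partial>hyp))"
    by (simp add: nn_integral_add nn_integral_cmult nn_integral_suminf)
  also have "(\<lambda>n. (\<integral>\<^sup>+x. indicator {s. (real (Suc n))\<^sup>2 \<le> s\<^sup>2} (w x) \<partial>hyp)) =
      (\<lambda>n. emeasure hyp {x. (real (Suc n))\<^sup>2 \<le> (w x)\<^sup>2})"
  proof
    fix n
    have "(\<integral>\<^sup>+x. indicator {s. (real (Suc n))\<^sup>2 \<le> s\<^sup>2} (w x) \<partial>hyp) = (\<integral>\<^sup>+x. indicator {x. (real (Suc n))\<^sup>2 \<le> (w x)\<^sup>2} x \<partial>hyp)"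
      by (intro nn_integral_cong) (simp add: indicator_def)
    also have "\<dots> = emeasure hyp {x. (real (Suc n))\<^sup>2 \<le> (w x)\<^sup>2}"
      by (intro nn_integral_indicator) simp
    finally show "(\<integral>\<^sup>+x. indicator {s. (real (Suc n))\<^sup>2 \<le> s\<^sup>2} (w x) \<partial>hyp) = emeasure hyp {x. (real (Suc n))\<^sup>2 \<le> (w x)\<^sup>2}" .
  qed
  also have "(\<Sum>n. ennreal (exp (\<alpha> * (real (Suc (Suc n)))\<^sup>2)) * emeasure hyp {x. (real (Suc n))\<^sup>2 \<le> (w x)\<^sup>2}) \<le>
     (\<Sum>n. ennreal ((1 / 2) ^ Suc n))"
  proof (rule suminf_le)
    fix n
    let ?m = "Suc n"
    have "ennreal (exp (\<alpha> * (real (Suc ?m))\<^sup>2)) * emeasure hyp {x. (real ?m)\<^sup>2 \<le> (w x)\<^sup>2} \<le>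
        ennreal (exp (4 * \<alpha>) ^ ?m\<^sup>2) * ennreal ((256 * \<epsilon>) ^ ?m\<^sup>2)"
    proof (intro mult_mono ennreal_leI level_decay[OF w _ E])
      have "(real (Suc ?m))\<^sup>2 \<le> (2 * real ?m)\<^sup>2" by (intro power_mono) auto
      then have "\<alpha> * (real (Suc ?m))\<^sup>2 \<le> \<alpha> * (2 * real ?m)\<^sup>2" using \<alpha> by (rule mult_left_mono)
      also have "\<dots> = real (?m\<^sup>2) * (4 * \<alpha>)" by (simp add: power2_eq_square algebra_simps)
      finally show "exp (\<alpha> * (real (Suc ?m))\<^sup>2) \<le> exp (4 * \<alpha>) ^ ?m\<^sup>2"
        by (simp only: exp_of_nat_mult[symmetric] exp_le_cancel_iff)
    qed (use eps in auto)
    also have "\<dots> = ennreal ((1 / 2) ^ ?m\<^sup>2)"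
      using eps by (simp add: \<epsilon>_def flip: ennreal_mult power_mult_distrib)
    also have "\<dots> \<le> ennreal ((1 / 2) ^ ?m)"
      by (intro ennreal_leI power_decreasing) (auto simp: power2_eq_square)
    finally show "ennreal (exp (\<alpha> * (real (Suc ?m))\<^sup>2)) * emeasure hyp {x. (real ?m)\<^sup>2 \<le> (w x)\<^sup>2} \<le> ennreal ((1 / 2) ^ ?m)" .
  qed auto
  also have "(\<Sum>n. ennreal ((1 / 2) ^ Suc n)) = ennreal 1"
    by (rule suminf_ennreal_eq[OF _ power_half_series]) simp
  also have "(\<integral>\<^sup>+x. ennreal ((w x)\<^sup>2) \<partial>hyp) \<le> ennreal \<epsilon>"
    using hardy[OF w] E by (rule order_trans)
  finally show "(\<integral>\<^sup>+x. ennreal (exp (\<alpha> * (w x)\<^sup>2) - 1) \<partial>hyp) \<le> ennreal (\<alpha> * exp \<alpha> * \<epsilon> + 1)"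
    using \<alpha> eps by (simp add: ennreal_mult ennreal_plus mult_left_mono)
qed

subsection \<open>Weak gradients\<close>

lemma borel_measurable_lebesgue_onI:
  "f \<in> borel_measurable borel \<Longrightarrow> f \<in> borel_measurable (lebesgue_on U)"
  by (intro measurable_restrict_space1 measurable_completion) simp

lemma flat_tendsto_1: "(flat 0 \<longlongrightarrow> 1) at_top"
proof -
  have "((\<lambda>s::real. exp (- (1 / s))) \<longlongrightarrow> exp (- 0)) at_top"
    by (intro tendsto_intros tendsto_divide_0[OF tendsto_const] filterlim_at_top_imp_at_infinity filterlim_ident)
  moreover have "\<forall>\<^sub>F s in at_top. exp (- (1 / s)) = flat 0 s"
    using eventually_gt_at_top[of 0] by eventually_elim (simp add: flat_def)
  ultimately show ?thesis using tendsto_cong by fastforce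
qed

text \<open>Countably many balls with closures in \<open>V\<close> cover \<open>V\<close>. The
  partial sums of their bumps are eventually bounded below by a positive number at each point of
  \<open>V\<close> and vanish off \<open>V\<close>; multiplying by \<open>n\<close> and applying
  \<open>flat 0\<close> drives them to 1 on \<open>V\<close>, keeps 0 elsewhere, and stays within
  [0, 1].\<close>

lemma test_functions_approx_open:
  fixes V :: "'a::euclidean_space set"
  assumes "open V" "V \<subseteq> U"
  obtains \<psi> where "\<And>n::nat. \<psi> n \<in> test_functions U" "\<And>n x. 0 \<le> \<psi> n x \<and> \<psi> n x \<le> 1"
    "\<And>x. (\<lambda>n. \<psi> n x) \<longlonglongrightarrow> indicator V x"
proof (cases "V = {}")
  case True
  then show thesis using that[of "\<lambda>_ _. 0"] by (simp add: test_functions_zero)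
next
  case False
  define \<F> where "\<F> = {ball a r | a r. 0 < r \<and> cball a r \<subseteq> V}"
  have "\<And>S. S \<in> \<F> \<Longrightarrow> open S" by (auto simp: \<F>_def)
  then obtain \<F>' where F': "\<F>' \<subseteq> \<F>" "countable \<F>'" "\<Union>\<F>' = \<Union>\<F>"
    by (rule Lindelof)
  have "V \<subseteq> \<Union>\<F>"
  proof
    fix x assume "x \<in> V"
    then obtain r where "r > 0" "cball x r \<subseteq> V" using assms(1) open_contains_cball by blast
    then show "x \<in> \<Union>\<F>" unfolding \<F>_def by (intro UnionI[of "ball x r"]) auto
  qed
  then have V: "V \<subseteq> \<Union>\<F>'" using F' by simp
  then have "\<F>' \<noteq> {}" using False by auto
  then have enum: "range (from_nat_into \<F>') = \<F>'" using F'(2) by (rule range_from_nat_into)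
  have "\<forall>i. \<exists>a r. from_nat_into \<F>' i = ball a r \<and> 0 < r \<and> cball a r \<subseteq> V"
  proof
    fix i
    have "from_nat_into \<F>' i \<in> \<F>" using enum F'(1) by blast
    then show "\<exists>a r. from_nat_into \<F>' i = ball a r \<and> 0 < r \<and> cball a r \<subseteq> V"
      by (auto simp: \<F>_def)
  qed
  then obtain a r where ar: "\<And>i. from_nat_into \<F>' i = ball (a i) (r i)" "\<And>i. 0 < r i" "\<And>i. cball (a i) (r i) \<subseteq> V"
    by metis
  define \<phi> where "\<phi> n x = (\<Sum>i<n. bump (a i) (r i) x)" for n x
  have \<phi>: "\<phi> n \<in> test_functions U" for n
    unfolding \<phi>_def[abs_def]
    by (intro test_functions_sum bump_test_function ar(2) order_trans[OF ar(3) assms(2)]) auto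
  define \<psi> where "\<psi> n x = flat 0 (real n * \<phi> n x)" for n x
  show thesis
  proof (rule that[of \<psi>])
    show "\<psi> n \<in> test_functions U" for n
      unfolding \<psi>_def[abs_def] by (rule test_functions_flat[OF \<phi>])
    show "0 \<le> \<psi> n x \<and> \<psi> n x \<le> 1" for n x by (simp add: \<psi>_def flat_0_bounds)
    fix x
    show "(\<lambda>n. \<psi> n x) \<longlonglongrightarrow> indicator V x"
    proof (cases "x \<in> V")
      case True
      then obtain i where "x \<in> ball (a i) (r i)" using V enum ar(1) by (metis UnionE imageE subsetD)
      then have "bump (a i) (r i) x \<noteq> 0" using bump_nonzero_iff[OF ar(2)] by blast
      then have c: "bump (a i) (r i) x > 0" using bump_nonneg[of "a i" "r i" x] by linarith
      have ge: "bump (a i) (r i) x \<le> \<phi> n x" if "i < n" for n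
        unfolding \<phi>_def using that by (intro member_le_sum) (auto simp: bump_nonneg)
      have "filterlim (\<lambda>n. real n * bump (a i) (r i) x) at_top sequentially"
        using c filterlim_tendsto_pos_mult_at_top[OF tendsto_const c filterlim_real_sequentially]
        by (simp add: mult.commute)
      moreover have "\<forall>\<^sub>F n in sequentially. real n * bump (a i) (r i) x \<le> real n * \<phi> n x"
        using eventually_gt_at_top[of i] by eventually_elim (intro mult_left_mono ge, auto)
      ultimately have "filterlim (\<lambda>n. real n * \<phi> n x) at_top sequentially"
        by (rule filterlim_at_top_mono)
      from filterlim_compose[OF flat_tendsto_1 this] show ?thesis
        using True by (simp add: \<psi>_def)
    next
      case False
      have "bump (a i) (r i) x = 0" for i
        using False ar(3)[of i] bump_nonzero_iff[OF ar(2)[of i], of "a i" x] ball_subset_cball by blast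
      then have "\<psi> n x = 0" for n by (simp add: \<psi>_def \<phi>_def flat_def)
      then show ?thesis using False by simp
    qed
  qed
qed

lemma test_function_measurable:
  assumes "\<phi> \<in> test_functions U"
  shows "\<phi> \<in> borel_measurable (lebesgue_on S)" "grad \<phi> \<in> borel_measurable (lebesgue_on S)"
  using C1_supp_measurable[OF test_function_C1_supp[OF assms]] by (auto intro: borel_measurable_lebesgue_onI)

text \<open>The fundamental lemma of the calculus of variations. The vanishing integral passes from
  test functions to indicators of open sets by dominated convergence, to Borel sets because open
  sets form an intersection-stable generator, and to Lebesgue sets by discarding a null set.\<close>

lemma integral_test_functions_zero_imp_AE:
  fixes h :: "'a::euclidean_space \<Rightarrow> real"
  assumes U: "open U" and h: "integrable (lebesgue_on U) h"
    and zero: "\<And>\<phi>. \<phi> \<in> test_functions U \<Longrightarrow> (\<integral>x. h x * \<phi> x \<partial>lebesgue_on U) = 0"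
  shows "AE x in lebesgue_on U. h x = 0"
proof (rule density_unique_real[OF h integrable_zero])
  note [measurable] = borel_measurable_integrable[OF h]
  let ?M = "lebesgue_on U"
  have open_zero: "(\<integral>x. h x * indicator V x \<partial>?M) = 0" if V: "open V" "V \<subseteq> U" for V
  proof -
    obtain \<psi> where \<psi>: "\<And>n::nat. \<psi> n \<in> test_functions U" "\<And>n x. 0 \<le> \<psi> n x \<and> \<psi> n x \<le> 1"
      "\<And>x. (\<lambda>n. \<psi> n x) \<longlonglongrightarrow> indicator V x"
      by (rule test_functions_approx_open[OF V], rule that)
    note [measurable] = test_function_measurable[OF \<psi>(1)]
    have [measurable]: "(indicator V :: 'a \<Rightarrow> real) \<in> borel_measurable ?M"
      using V(1) by (intro borel_measurable_lebesgue_onI) simp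
    have "(\<lambda>n. \<integral>x. h x * \<psi> n x \<partial>?M) \<longlonglongrightarrow> (\<integral>x. h x * indicator V x \<partial>?M)"
    proof (rule integral_dominated_convergence[where w="\<lambda>x. \<bar>h x\<bar>"])
      show "AE x in ?M. (\<lambda>n. h x * \<psi> n x) \<longlonglongrightarrow> h x * indicator V x"
        by (intro AE_I2 tendsto_intros \<psi>)
      show "AE x in ?M. norm (h x * \<psi> n x) \<le> \<bar>h x\<bar>" for n
        using \<psi>(2)[of n] by (intro AE_I2) (simp add: abs_mult mult_left_le)
    qed (use h in auto)
    then show ?thesis using zero[OF \<psi>(1)] by (simp add: LIMSEQ_const_iff)
  qed
  have ind: "(indicator A :: 'a \<Rightarrow> real) \<in> borel_measurable ?M" if "A \<in> sets borel" for A
    using that by (intro borel_measurable_lebesgue_onI) simp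
  have intA: "integrable ?M (\<lambda>x. h x * indicator A x)" if "A \<in> sets borel" for A
  proof (rule Bochner_Integration.integrable_bound[OF h])
    show "(\<lambda>x. h x * indicator A x) \<in> borel_measurable ?M"
      using ind[OF that] by measurable
    show "AE x in ?M. norm (h x * indicator A x) \<le> norm (h x)"
      by (intro AE_I2) (simp add: indicator_def)
  qed
  \<comment> \<open>Needed for complements in the induction over Borel sets.\<close>
  have total: "(\<integral>x. h x \<partial>?M) = 0"
  proof -
    have "(\<integral>x. h x \<partial>?M) = (\<integral>x. h x * indicator U x \<partial>?M)"
      by (intro Bochner_Integration.integral_cong) auto
    then show ?thesis using open_zero[OF U] by simp
  qed
  have borel_zero: "(\<integral>x. h x * indicator A x \<partial>?M) = 0" if "A \<in> sets borel" for A
  proof -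
    have "Int_stable {S::'a set. open S}" by (auto simp: Int_stable_def)
    moreover have "{S::'a set. open S} \<subseteq> Pow UNIV" by simp
    moreover have "A \<in> sigma_sets UNIV {S. open S}" using that by (simp add: borel_def)
    ultimately show ?thesis
    proof (induction rule: sigma_sets_induct_disjoint)
      case (basic V)
      have "(\<integral>x. h x * indicator V x \<partial>?M) = (\<integral>x. h x * indicator (V \<inter> U) x \<partial>?M)"
        by (intro Bochner_Integration.integral_cong) (auto simp: indicator_def)
      then show ?case using open_zero[of "V \<inter> U"] basic U by auto
    next
      case (compl A)
      then have A: "A \<in> sets borel" by (simp add: borel_def)
      have "(\<integral>x. h x * indicator (UNIV - A) x \<partial>?M) = (\<integral>x. h x - h x * indicator A x \<partial>?M)"
        by (intro Bochner_Integration.integral_cong) (auto simp: indicator_def)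
      then show ?case using compl total h intA[OF A] by simp
    next
      case (union A)
      then have A: "A i \<in> sets borel" for i by (auto simp: borel_def)
      have "(\<lambda>n. \<integral>x. h x * indicator (\<Union>i<n. A i) x \<partial>?M) \<longlonglongrightarrow> (\<integral>x. h x * indicator (\<Union>i. A i) x \<partial>?M)"
      proof (rule integral_dominated_convergence[where w="\<lambda>x. \<bar>h x\<bar>"])
        show "AE x in ?M. (\<lambda>n. h x * indicator (\<Union>i<n. A i) x) \<longlonglongrightarrow> h x * indicator (\<Union>i. A i) x"
          by (intro AE_I2 tendsto_intros LIMSEQ_indicator_UN)
        show "AE x in ?M. norm (h x * indicator (\<Union>i<n. A i) x) \<le> \<bar>h x\<bar>" for n
          by (intro AE_I2) (simp add: indicator_def)
        show "(\<lambda>x. h x * indicator (\<Union>i. A i) x) \<in> borel_measurable ?M"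
          using A intA[of "\<Union>i. A i"] by auto
        show "(\<lambda>x. h x * indicator (\<Union>i<n. A i) x) \<in> borel_measurable ?M" for n
          using A intA[of "\<Union>i<n. A i"] by auto
      qed (use h in auto)
      moreover have "(\<integral>x. h x * indicator (\<Union>i<n. A i) x \<partial>?M) = 0" for n
      proof -
        have "indicator (\<Union>i<n. A i) x = (\<Sum>i<n. indicator (A i) x :: real)" for x
          using union(1) by (intro indicator_UN_disjoint) (auto simp: disjoint_family_on_def)
        then have "(\<integral>x. h x * indicator (\<Union>i<n. A i) x \<partial>?M) = (\<integral>x. (\<Sum>i<n. h x * indicator (A i) x) \<partial>?M)"
          by (simp add: sum_distrib_left)
        also have "\<dots> = (\<Sum>i<n. \<integral>x. h x * indicator (A i) x \<partial>?M)"
          by (intro Bochner_Integration.integral_sum intA A)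
        finally show ?thesis using union(3) by simp
      qed
      ultimately show ?case by (simp add: LIMSEQ_const_iff)
    qed simp
  qed
  \<comment> \<open>A measurable set of the restricted completion is the trace on \<open>U\<close>
    of a Borel set \<open>S\<close> together with part of a Borel null set, so \<open>A\<close> may
    be replaced by \<open>S\<close>.\<close>
  fix A assume "A \<in> sets ?M"
  then obtain B where B: "B \<in> sets lebesgue" "A = U \<inter> B"
    by (auto simp: sets_restrict_space)
  then obtain S N N' where S: "B = S \<union> N" "S \<in> sets lborel" "N' \<in> null_sets lborel" "N \<subseteq> N'"
    by (auto elim: sets_completionE)
  have N': "AE x in ?M. x \<notin> N'"
  proof -
    have "AE x in lebesgue. x \<notin> N'"
      using S(3) AE_not_in null_sets_completionI by blast
    then have "AE x in lebesgue. x \<in> U \<longrightarrow> x \<notin> N'" by (rule eventually_mono) simp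
    then show ?thesis using U by (simp add: AE_restrict_space_iff)
  qed
  have "set_lebesgue_integral ?M A h = (\<integral>x. h x * indicator S x \<partial>?M)"
    unfolding set_lebesgue_integral_def
  proof (rule integral_cong_AE)
    show "AE x in ?M. indicator A x *\<^sub>R h x = h x * indicator S x"
      using N' AE_space[of ?M] by eventually_elim (use B(2) S in \<open>auto simp: indicator_def\<close>)
    show "(\<lambda>x. indicator A x *\<^sub>R h x) \<in> borel_measurable ?M"
      using \<open>A \<in> sets ?M\<close> by measurable
    show "(\<lambda>x. h x * indicator S x) \<in> borel_measurable ?M"
      using S(2) intA[of S] by auto
  qed
  then show "set_lebesgue_integral ?M A h = set_lebesgue_integral ?M A (\<lambda>_. 0)"
    using borel_zero S(2) by simp
qed

section \<open>Square integrable functions and rules for weak gradients\<close>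

lemma norm_add_square_le: "(norm (a + b))\<^sup>2 \<le> 2 * (norm a)\<^sup>2 + 2 * (norm b)\<^sup>2"
  for a b :: "'a::real_normed_vector"
proof -
  have "(norm (a + b))\<^sup>2 \<le> (norm a + norm b)\<^sup>2" by (intro power_mono norm_triangle_ineq) simp
  also have "\<dots> \<le> 2 * (norm a)\<^sup>2 + 2 * (norm b)\<^sup>2"
    using zero_le_power2[of "norm a - norm b"] by (simp add: power2_sum power2_diff)
  finally show ?thesis .
qed

lemma L2_add:
  assumes "f \<in> L2 U" "g \<in> L2 U"
  shows "(\<lambda>x. f x + g x) \<in> L2 U"
proof -
  have [measurable]: "f \<in> borel_measurable (lebesgue_on U)" "g \<in> borel_measurable (lebesgue_on U)"
    using assms by (auto simp: L2_def)
  have "integrable (lebesgue_on U) (\<lambda>x. 2 * (norm (f x))\<^sup>2 + 2 * (norm (g x))\<^sup>2)"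
    using assms by (auto simp: L2_def)
  then have "integrable (lebesgue_on U) (\<lambda>x. (norm (f x + g x))\<^sup>2)"
    by (rule Bochner_Integration.integrable_bound) (auto intro!: AE_I2 order_trans[OF norm_add_square_le])
  then show ?thesis by (simp add: L2_def)
qed

lemma L2_scaleR:
  assumes "f \<in> L2 U"
  shows "(\<lambda>x. c *\<^sub>R f x) \<in> L2 U"
  using assms by (auto simp: L2_def power_mult_distrib)

lemma L2_diff:
  assumes "f \<in> L2 U" "g \<in> L2 U"
  shows "(\<lambda>x. f x - g x) \<in> L2 U"
  using L2_add[OF assms(1) L2_scaleR[OF assms(2), of "-1"]] by simp

lemma L2_mult_integrable:
  fixes f g :: "'a::euclidean_space \<Rightarrow> real"
  assumes "f \<in> L2 U" "g \<in> L2 U"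
  shows "integrable (lebesgue_on U) (\<lambda>x. f x * g x)"
proof -
  have [measurable]: "f \<in> borel_measurable (lebesgue_on U)" "g \<in> borel_measurable (lebesgue_on U)"
    using assms by (auto simp: L2_def)
  have "integrable (lebesgue_on U) (\<lambda>x. (norm (f x))\<^sup>2 + (norm (g x))\<^sup>2)"
    using assms by (auto simp: L2_def)
  then show ?thesis
  proof (rule Bochner_Integration.integrable_bound)
    have "\<bar>f x * g x\<bar> \<le> (f x)\<^sup>2 + (g x)\<^sup>2" for x
      using sum_squares_bound[of "\<bar>f x\<bar>" "\<bar>g x\<bar>"] mult_nonneg_nonneg[of "\<bar>f x\<bar>" "\<bar>g x\<bar>"]
      unfolding abs_mult power2_abs by linarith
    then show "AE x in lebesgue_on U. norm (f x * g x) \<le> norm ((norm (f x))\<^sup>2 + (norm (g x))\<^sup>2)"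
      by (intro AE_I2) simp
  qed simp
qed

lemma L2_inner:
  assumes "f \<in> L2 U" "b \<in> Basis"
  shows "(\<lambda>x. f x \<bullet> b) \<in> L2 U"
proof -
  have [measurable]: "f \<in> borel_measurable (lebesgue_on U)" using assms by (auto simp: L2_def)
  have "integrable (lebesgue_on U) (\<lambda>x. (norm (f x))\<^sup>2)" using assms by (auto simp: L2_def)
  then have "integrable (lebesgue_on U) (\<lambda>x. (norm (f x \<bullet> b))\<^sup>2)"
  proof (rule Bochner_Integration.integrable_bound)
    have "(f x \<bullet> b)\<^sup>2 \<le> (norm (f x))\<^sup>2" for x
      using power_mono[OF Basis_le_norm[OF assms(2), of "f x"], of 2] by simp
    then show "AE x in lebesgue_on U. norm ((norm (f x \<bullet> b))\<^sup>2) \<le> norm ((norm (f x))\<^sup>2)"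
      by (intro AE_I2) simp
  qed simp
  then show ?thesis by (simp add: L2_def)
qed

lemma L2_integrable:
  fixes f :: "'a::euclidean_space \<Rightarrow> real"
  assumes "bounded U" "open U" "f \<in> L2 U"
  shows "integrable (lebesgue_on U) f"
proof -
  have "emeasure (lebesgue_on U) (space (lebesgue_on U)) < \<infinity>"
    using emeasure_bounded_finite[OF assms(1)] assms(2) by (simp add: emeasure_restrict_space)
  then have "integrable (lebesgue_on U) (\<lambda>_. 1::real)"
    by (simp add: integrable_iff_bounded)
  then have "(\<lambda>_. 1::real) \<in> L2 U" by (simp add: L2_def)
  from L2_mult_integrable[OF assms(3) this] show ?thesis by simp
qed

lemma C1_supp_L2:
  assumes "open U" "C1_supp U f G"
  shows "f \<in> L2 U" "G \<in> L2 U"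
proof -
  note [measurable] = C1_supp_measurable[OF assms(2)] and cont = C1_supp_continuous[OF assms(2)]
  obtain K where K: "compact K" "K \<subseteq> U" "\<And>x. x \<notin> K \<Longrightarrow> f x = 0 \<and> G x = 0"
    using assms(2) by (auto simp: C1_supp_def)
  have "integrable lborel (\<lambda>x. (norm (f x))\<^sup>2)" "integrable lborel (\<lambda>x. (norm (G x))\<^sup>2)"
    using K cont by (auto intro!: integrable_compact_support[where K=K] continuous_intros)
  then have "integrable (lebesgue_on U) (\<lambda>x. (norm (f x))\<^sup>2)" "integrable (lebesgue_on U) (\<lambda>x. (norm (G x))\<^sup>2)"
    using assms(1) K(2,3) by (subst integral_lebesgue_on_eq; auto)+
  then show "f \<in> L2 U" "G \<in> L2 U"
    unfolding L2_def by (auto intro: borel_measurable_lebesgue_onI)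
qed

lemma test_function_L2:
  assumes "open U" "\<phi> \<in> test_functions U"
  shows "\<phi> \<in> L2 U" "grad \<phi> \<in> L2 U"
  using C1_supp_L2[OF assms(1) test_function_C1_supp[OF assms(2)]] by auto

lemma test_function_partial_deriv:
  assumes "\<phi> \<in> test_functions U"
  shows "partial_deriv b \<phi> x = grad \<phi> x \<bullet> b"
  using test_function_C1_supp[OF assms] by (auto simp: C1_supp_def intro: partial_deriv_eqI)

lemma test_function_grad_add:
  assumes "\<phi> \<in> test_functions U" "\<psi> \<in> test_functions U"
  shows "grad (\<lambda>x. \<phi> x + \<psi> x) x = grad \<phi> x + grad \<psi> x"
  using test_function_C1_supp[OF assms(1)] test_function_C1_supp[OF assms(2)]
  by (intro grad_eqI GDERIV_add) (auto simp: C1_supp_def)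

lemma test_function_grad_cmult:
  assumes "\<phi> \<in> test_functions U"
  shows "grad (\<lambda>x. c * \<phi> x) x = c *\<^sub>R grad \<phi> x"
proof -
  have "GDERIV (\<lambda>x. c * \<phi> x) x :> c *\<^sub>R grad \<phi> x + \<phi> x *\<^sub>R 0"
    using test_function_C1_supp[OF assms] by (intro GDERIV_mult GDERIV_const) (auto simp: C1_supp_def)
  then show ?thesis by (simp add: grad_eqI)
qed

lemma test_function_grad_sum:
  assumes "finite I" "\<And>i. i \<in> I \<Longrightarrow> \<phi> i \<in> test_functions U"
  shows "grad (\<lambda>x. \<Sum>i\<in>I. \<phi> i x) x = (\<Sum>i\<in>I. grad (\<phi> i) x)"
  using assms
proof (induction I rule: finite_induct)
  case empty
  then show ?case by (simp add: grad_eqI[OF GDERIV_const])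
next
  case (insert i I)
  then show ?case
    by (simp add: test_function_grad_add[OF _ test_functions_sum[of I \<phi> U]])
qed

lemma has_weak_grad_test_function:
  assumes "open U" "\<phi> \<in> test_functions U"
  shows "has_weak_grad U \<phi> (grad \<phi>)"
  unfolding has_weak_grad_def
  using C1_supp_integral_by_parts[OF assms(1) test_function_C1_supp[OF assms(2)] test_function_C1_supp]
  by (simp add: test_function_partial_deriv)

lemma has_weak_grad_add:
  assumes "open U" "u \<in> L2 U" "g \<in> L2 U" "v \<in> L2 U" "h \<in> L2 U" "has_weak_grad U u g" "has_weak_grad U v h"
  shows "has_weak_grad U (\<lambda>x. u x + v x) (\<lambda>x. g x + h x)"
  unfolding has_weak_grad_def
proof (intro ballI)
  fix \<phi> and b :: 'a assume \<phi>: "\<phi> \<in> test_functions U" and b: "b \<in> Basis"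
  note t = test_function_L2[OF assms(1) \<phi>]
  have [simp]: "integrable (lebesgue_on U) (\<lambda>x. u x * (grad \<phi> x \<bullet> b))" "integrable (lebesgue_on U) (\<lambda>x. v x * (grad \<phi> x \<bullet> b))"
    "integrable (lebesgue_on U) (\<lambda>x. (g x \<bullet> b) * \<phi> x)" "integrable (lebesgue_on U) (\<lambda>x. (h x \<bullet> b) * \<phi> x)"
    by (intro L2_mult_integrable L2_inner assms t b)+
  show "(\<integral>x. (u x + v x) * partial_deriv b \<phi> x \<partial>lebesgue_on U) = - (\<integral>x. ((g x + h x) \<bullet> b) * \<phi> x \<partial>lebesgue_on U)"
    using assms(6,7)[unfolded has_weak_grad_def, rule_format, OF \<phi> b]
    by (simp add: test_function_partial_deriv[OF \<phi>] inner_add_left distrib_right)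
qed

text \<open>\<open>weak_grad\<close> is a Hilbert choice; this uniqueness is what identifies the
  chosen gradient with an explicit one almost everywhere. The fundamental lemma is applied to each
  component of the difference, which is integrable because \<open>U\<close> is bounded.\<close>

lemma weak_grad_unique:
  assumes "bounded U" "open U" "g \<in> L2 U" "h \<in> L2 U" "has_weak_grad U u g" "has_weak_grad U u h"
  shows "AE x in lebesgue_on U. g x = h x"
proof -
  have "AE x in lebesgue_on U. (g x - h x) \<bullet> b = 0" if b: "b \<in> Basis" for b
  proof (rule integral_test_functions_zero_imp_AE[OF assms(2)])
    show "integrable (lebesgue_on U) (\<lambda>x. (g x - h x) \<bullet> b)"
      by (intro L2_integrable L2_inner L2_diff assms b)
    fix \<phi> assume \<phi>: "\<phi> \<in> test_functions U"
    note t = test_function_L2[OF assms(2) \<phi>]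
    have [simp]: "integrable (lebesgue_on U) (\<lambda>x. (g x \<bullet> b) * \<phi> x)" "integrable (lebesgue_on U) (\<lambda>x. (h x \<bullet> b) * \<phi> x)"
      by (intro L2_mult_integrable L2_inner assms t b)+
    show "(\<integral>x. ((g x - h x) \<bullet> b) * \<phi> x \<partial>lebesgue_on U) = 0"
      using assms(5,6) \<phi> b by (simp add: has_weak_grad_def inner_diff_left left_diff_distrib)
  qed
  then have "AE x in lebesgue_on U. \<forall>b\<in>Basis. (g x - h x) \<bullet> b = 0"
    by (intro AE_finite_allI) auto
  then show ?thesis
    by eventually_elim (metis eq_iff_diff_eq_0 euclidean_all_zero_iff)
qed

lemma H1_weak_grad:
  assumes "u \<in> H1 U"
  shows "u \<in> L2 U" "weak_grad U u \<in> L2 U" "has_weak_grad U u (weak_grad U u)"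
proof -
  obtain g where "g \<in> L2 U \<and> has_weak_grad U u g" using assms by (auto simp: H1_def)
  then have "weak_grad U u \<in> L2 U \<and> has_weak_grad U u (weak_grad U u)"
    unfolding weak_grad_def by (rule someI[of "\<lambda>g. g \<in> L2 U \<and> has_weak_grad U u g"])
  then show "weak_grad U u \<in> L2 U" "has_weak_grad U u (weak_grad U u)" by auto
  show "u \<in> L2 U" using assms by (auto simp: H1_def)
qed

lemma weak_grad_AE:
  assumes "bounded U" "open U" "u \<in> L2 U" "g \<in> L2 U" "has_weak_grad U u g"
  shows "u \<in> H1 U" "AE x in lebesgue_on U. weak_grad U u x = g x"
proof -
  show "u \<in> H1 U" using assms by (auto simp: H1_def)
  from H1_weak_grad[OF this] show "AE x in lebesgue_on U. weak_grad U u x = g x"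
    using assms by (intro weak_grad_unique) auto
qed

lemma L2_norm_cong_AE:
  assumes "f \<in> borel_measurable (lebesgue_on U)" "g \<in> borel_measurable (lebesgue_on U)"
    "AE x in lebesgue_on U. f x = g x"
  shows "L2_norm U f = L2_norm U g"
  unfolding L2_norm_def using assms
  by (intro arg_cong[where f=sqrt] integral_cong_AE) auto

lemma L2_measurable: "f \<in> L2 U \<Longrightarrow> f \<in> borel_measurable (lebesgue_on U)"
  by (simp add: L2_def)

lemma H01_test_function:
  assumes U: "bounded U" "open U" and \<phi>: "\<phi> \<in> test_functions U"
  shows "\<phi> \<in> H01 U" "H01_norm U \<phi> = L2_norm U (grad \<phi>)"
proof -
  note t = test_function_L2[OF U(2) \<phi>]
  note w = weak_grad_AE[OF U t has_weak_grad_test_function[OF U(2) \<phi>]]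
  note W = H1_weak_grad[OF w(1)]
  note [measurable] = t[THEN L2_measurable] W(2)[THEN L2_measurable]
  have "L2_norm U (\<lambda>x. grad \<phi> x - weak_grad U \<phi> x) = L2_norm U (\<lambda>x. 0 :: 'a)"
    by (rule L2_norm_cong_AE) (use w(2) in auto)
  then show "\<phi> \<in> H01 U"
    unfolding H01_def using w(1) \<phi> by (auto simp: L2_norm_def intro!: exI[of _ "\<lambda>_. \<phi>"])
  show "H01_norm U \<phi> = L2_norm U (grad \<phi>)"
    unfolding H01_norm_def by (rule L2_norm_cong_AE) (use w(2) in auto)
qed

text \<open>Adding \<phi> to every member of an approximating sequence leaves the differences of
  values unchanged, and those of gradients unchanged almost everywhere.\<close>

lemma H01_add_test_function:
  assumes U: "bounded U" "open U" and u: "u \<in> H01 U" and \<phi>: "\<phi> \<in> test_functions U"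
  shows "(\<lambda>x. u x + \<phi> x) \<in> H01 U"
proof -
  have "u \<in> H1 U" using u by (simp add: H01_def)
  note u' = H1_weak_grad[OF this]
  note t = test_function_L2[OF U(2) \<phi>]
  note w = weak_grad_AE[OF U L2_add[OF u'(1) t(1)] L2_add[OF u'(2) t(2)]
      has_weak_grad_add[OF U(2) u'(1,2) t u'(3) has_weak_grad_test_function[OF U(2) \<phi>]]]
  note W = H1_weak_grad[OF w(1)]
  obtain f where f: "\<And>k. f k \<in> test_functions U" "(\<lambda>k. L2_norm U (\<lambda>x. f k x - u x)) \<longlonglongrightarrow> 0"
     "(\<lambda>k. L2_norm U (\<lambda>x. grad (f k) x - weak_grad U u x)) \<longlonglongrightarrow> 0"
    using u by (auto simp: H01_def)
  note ft = test_function_L2[OF U(2) f(1)]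
  note [measurable] = t[THEN L2_measurable] u'(2)[THEN L2_measurable] W(2)[THEN L2_measurable] ft[THEN L2_measurable]
  have "L2_norm U (\<lambda>x. grad (\<lambda>x. f k x + \<phi> x) x - weak_grad U (\<lambda>x. u x + \<phi> x) x)
      = L2_norm U (\<lambda>x. grad (f k) x - weak_grad U u x)" for k
    unfolding test_function_grad_add[OF f(1) \<phi>] by (rule L2_norm_cong_AE) (use w(2) in auto)
  then show ?thesis
    unfolding H01_def using w(1) f
    by (auto intro!: exI[of _ "\<lambda>k x. f k x + \<phi> x"] test_functions_add \<phi>)
qed

subsection \<open>Weak discontinuity\<close>

lemma L2_norm_nonneg: "0 \<le> L2_norm U f"
  by (simp add: L2_norm_def)

lemma L2_norm_square: "(L2_norm U f)\<^sup>2 = (\<integral>x. (norm (f x))\<^sup>2 \<partial>lebesgue_on U)"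
  by (simp add: L2_norm_def)

lemma L2_norm_add_square:
  assumes "f \<in> L2 U" "g \<in> L2 U"
  shows "(L2_norm U (\<lambda>x. f x + g x))\<^sup>2 \<le> 2 * (L2_norm U f)\<^sup>2 + 2 * (L2_norm U g)\<^sup>2"
proof -
  have "(\<integral>x. (norm (f x + g x))\<^sup>2 \<partial>lebesgue_on U) \<le> (\<integral>x. 2 * (norm (f x))\<^sup>2 + 2 * (norm (g x))\<^sup>2 \<partial>lebesgue_on U)"
    using assms L2_add[OF assms] by (intro integral_mono norm_add_square_le) (auto simp: L2_def)
  also have "\<dots> = 2 * (\<integral>x. (norm (f x))\<^sup>2 \<partial>lebesgue_on U) + 2 * (\<integral>x. (norm (g x))\<^sup>2 \<partial>lebesgue_on U)"
    using assms by (simp add: L2_def)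
  finally show ?thesis by (simp add: L2_norm_square)
qed

lemma test_function_energy:
  assumes "open U" "\<phi> \<in> test_functions U"
  shows "(\<integral>\<^sup>+x. ennreal ((norm (grad \<phi> x))\<^sup>2) \<partial>lborel) = ennreal ((L2_norm U (grad \<phi>))\<^sup>2)"
proof -
  note C = test_function_C1_supp[OF assms(2)]
  note [measurable] = C1_supp_measurable[OF C]
  have 0: "\<And>x. x \<notin> U \<Longrightarrow> (norm (grad \<phi> x))\<^sup>2 = 0" using C1_supp_outside[OF C] by simp
  have "integrable lborel (\<lambda>x. (norm (grad \<phi> x))\<^sup>2)"
    using C1_supp_L2(2)[OF assms(1) C] integral_lebesgue_on_eq(2)[of U "\<lambda>x. (norm (grad \<phi> x))\<^sup>2", OF _ _ 0] assms(1)
    by (auto simp: L2_def)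
  then have "(\<integral>\<^sup>+x. ennreal ((norm (grad \<phi> x))\<^sup>2) \<partial>lborel) = ennreal (\<integral>x. (norm (grad \<phi> x))\<^sup>2 \<partial>lborel)"
    by (intro nn_integral_eq_integral) auto
  also have "(\<integral>x. (norm (grad \<phi> x))\<^sup>2 \<partial>lborel) = (L2_norm U (grad \<phi>))\<^sup>2"
    unfolding L2_norm_square
    using assms(1) by (intro integral_lebesgue_on_eq(1)[symmetric] 0) auto
  finally show ?thesis .
qed

text \<open>An inequality rather than an equality because \<open>hyp\<close> also charges the
  complement of the disk.\<close>

lemma nn_integral_weight_le_hyp:
  fixes f :: "real^2 \<Rightarrow> real"
  assumes [measurable]: "f \<in> borel_measurable borel"
  shows "(\<integral>\<^sup>+x. ennreal (f x / (1 - (norm x)\<^sup>2)\<^sup>2) \<partial>lebesgue_on unit_disk) \<le> (\<integral>\<^sup>+x. ennreal (f x) \<partial>hyp)"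
proof -
  have "(\<integral>\<^sup>+x. ennreal (f x / (1 - (norm x)\<^sup>2)\<^sup>2) \<partial>lebesgue_on unit_disk) =
      (\<integral>\<^sup>+x. ennreal (f x / (1 - (norm x)\<^sup>2)\<^sup>2) * indicator unit_disk x \<partial>lborel)"
    by (simp add: nn_integral_restrict_space unit_disk_def nn_integral_completion)
  also have "\<dots> \<le> (\<integral>\<^sup>+x. ennreal (f x) \<partial>hyp)"
    unfolding nn_integral_hyp[of "\<lambda>x. ennreal (f x)", simplified]
    by (intro nn_integral_mono)
       (auto simp: indicator_def power2_norm_eq_inner divide_inverse power_inverse mult.commute simp flip: ennreal_mult'')
  finally show ?thesis .
qed

lemma unit_disk_open: "open unit_disk" "bounded unit_disk"
  by (auto simp: unit_disk_def)

text \<open>From u^2 \<le> 2 v^2 + 2 (u - v)^2 and exp(P + Q) - 1 = exp P (exp Q - 1) + (exp P - 1).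
  Either summant on the right vanishes to second order at zero, in u - v and in v respectively, so
  both remain integrable against the singular weight.\<close>

lemma exp_sum_split:
  fixes u v B :: real
  assumes "\<bar>v\<bar> \<le> B"
  shows "exp (4 * pi * u\<^sup>2) - 1 \<le>
    exp (8 * pi * B\<^sup>2) * (exp (8 * pi * (u - v)\<^sup>2) - 1) + 8 * pi * exp (8 * pi * B\<^sup>2) * v\<^sup>2"
proof -
  define P where "P = 8 * pi * v\<^sup>2"
  define Q where "Q = 8 * pi * (u - v)\<^sup>2"
  have "u\<^sup>2 \<le> 2 * v\<^sup>2 + 2 * (u - v)\<^sup>2"
    using norm_add_square_le[of v "u - v"] by simp
  then have "4 * pi * u\<^sup>2 \<le> 4 * pi * (2 * v\<^sup>2 + 2 * (u - v)\<^sup>2)"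
    by (intro mult_left_mono) auto
  then have "exp (4 * pi * u\<^sup>2) \<le> exp (P + Q)"
    by (simp add: P_def Q_def algebra_simps)
  moreover have "exp P \<le> exp (8 * pi * B\<^sup>2)"
    unfolding P_def exp_le_cancel_iff using power_mono[OF assms, of 2] by (intro mult_left_mono) auto
  moreover from this have "exp P * (exp Q - 1) \<le> exp (8 * pi * B\<^sup>2) * (exp Q - 1)"
    by (intro mult_right_mono) (auto simp: Q_def)
  moreover have "exp P - 1 \<le> P * exp P"
  proof -
    have "exp P * (1 - P) \<le> exp P * exp (- P)"
      using exp_ge_add_one_self[of "- P"] by (intro mult_left_mono) auto
    then show ?thesis by (simp add: algebra_simps flip: exp_add)
  qed
  moreover have "P * exp P \<le> P * exp (8 * pi * B\<^sup>2)"
    using calculation(2) by (intro mult_left_mono) (auto simp: P_def)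
  moreover have "exp (P + Q) - 1 = exp P * (exp Q - 1) + (exp P - 1)"
    by (simp add: exp_add algebra_simps)
  ultimately have "exp (4 * pi * u\<^sup>2) - 1 \<le> exp (8 * pi * B\<^sup>2) * (exp Q - 1) + P * exp (8 * pi * B\<^sup>2)"
    by linarith
  then show ?thesis by (simp add: P_def Q_def mult_ac)
qed

text \<open>The smooth part is a late member \<open>v\<close> of the approximating sequence. The
  Trudinger bound concerns C1 functions only, so it is applied to the differences f k - v, which
  have small energy for large k, and then carried to u - v by Fatou.\<close>

lemma J_finite:
  assumes u: "u \<in> H01 unit_disk"
  shows "J u < \<infinity>"
proof -
  let ?M = "lebesgue_on unit_disk"
  define wt :: "real^2 \<Rightarrow> real" where "wt x = 1 / (1 - (norm x)\<^sup>2)\<^sup>2" for x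
  have wt0: "wt x \<ge> 0" for x by (simp add: wt_def)
  obtain \<epsilon> C where eps: "\<epsilon> > 0" and trud: "\<And>w W. C1_supp (ball 0 1) (w :: real^2 \<Rightarrow> real) W \<Longrightarrow>
      (\<integral>\<^sup>+x. ennreal ((norm (W x))\<^sup>2) \<partial>lborel) \<le> ennreal \<epsilon> \<Longrightarrow>
      (\<integral>\<^sup>+x. ennreal (exp (8 * pi * (w x)\<^sup>2) - 1) \<partial>hyp) \<le> ennreal C"
    by (rule trudinger[of "8 * pi"], simp, rule that)
  have uH1: "u \<in> H1 unit_disk" using u by (simp add: H01_def)
  note u' = H1_weak_grad[OF uH1]
  define g where "g = weak_grad unit_disk u"
  obtain f where f: "\<And>k. f k \<in> test_functions unit_disk" "(\<lambda>k. L2_norm unit_disk (\<lambda>x. f k x - u x)) \<longlonglongrightarrow> 0"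
     "(\<lambda>k. L2_norm unit_disk (\<lambda>x. grad (f k) x - g x)) \<longlonglongrightarrow> 0"
    using u by (auto simp: H01_def g_def)
  note ft = test_function_L2[OF unit_disk_open(1) f(1)]
  have gL2: "g \<in> L2 unit_disk" using u' by (simp add: g_def)
  \<comment> \<open>The gradient of f k - v is a difference of two such errors;
    \<open>L2_norm_add_square\<close> doubles each square, and 2 * \<epsilon>/4 + 2 * \<epsilon>/4 =
    \<epsilon>.\<close>
  have "\<forall>\<^sub>F k in sequentially. L2_norm unit_disk (\<lambda>x. grad (f k) x - g x) < sqrt (\<epsilon> / 4)"
    using f(3) eps by (intro order_tendstoD) auto
  then obtain K where K: "\<And>k. k \<ge> K \<Longrightarrow> L2_norm unit_disk (\<lambda>x. grad (f k) x - g x) < sqrt (\<epsilon> / 4)"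
    by (auto simp: eventually_sequentially)
  have K2: "(L2_norm unit_disk (\<lambda>x. grad (f k) x - g x))\<^sup>2 \<le> \<epsilon> / 4" if "k \<ge> K" for k
    using power_mono[OF less_imp_le[OF K[OF that]] L2_norm_nonneg, of 2] eps by simp
  define v where "v = f K"
  have v: "v \<in> test_functions unit_disk" using f by (simp add: v_def)
  define w where "w k x = f k x - v x" for k x
  have w: "w k \<in> test_functions unit_disk" for k
    unfolding w_def[abs_def] by (intro test_functions_diff f v)
  have w_bound: "(\<integral>\<^sup>+x. ennreal (exp (8 * pi * (w k x)\<^sup>2) - 1) \<partial>hyp) \<le> ennreal C" if "k \<ge> K" for k
  proof (rule trud)
    show C1: "C1_supp (ball 0 1) (w k) (grad (w k))"
      using test_function_C1_supp[OF w] by (simp add: unit_disk_def)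
    have gw: "grad (w k) x = (grad (f k) x - g x) + (-1) *\<^sub>R (grad v x - g x)" for x
      using test_function_grad_add[OF f(1)[of k] test_functions_cmult[OF v, of "-1"]] test_function_grad_cmult[OF v, of "-1"]
      by (simp add: w_def[abs_def])
    have "(L2_norm unit_disk (grad (w k)))\<^sup>2 \<le> 2 * (L2_norm unit_disk (\<lambda>x. grad (f k) x - g x))\<^sup>2
       + 2 * (L2_norm unit_disk (\<lambda>x. (-1) *\<^sub>R (grad v x - g x)))\<^sup>2"
      unfolding gw[abs_def] by (intro L2_norm_add_square L2_scaleR L2_diff ft gL2 test_function_L2 unit_disk_open v)
    also have "\<dots> = 2 * (L2_norm unit_disk (\<lambda>x. grad (f k) x - g x))\<^sup>2
       + 2 * (L2_norm unit_disk (\<lambda>x. grad (f K) x - g x))\<^sup>2"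
      by (simp add: L2_norm_def v_def norm_minus_commute)
    also have "\<dots> \<le> \<epsilon>" using K2[OF that] K2[of K] by simp
    finally show "(\<integral>\<^sup>+x. ennreal ((norm (grad (w k) x))\<^sup>2) \<partial>lborel) \<le> ennreal \<epsilon>"
      using test_function_energy[OF unit_disk_open(1) w] by (simp add: ennreal_leI)
  qed
  \<comment> \<open>Fatou needs pointwise convergence, which L2 convergence supplies along a
    subsequence.\<close>
  have "\<exists>r::nat\<Rightarrow>nat. strict_mono r \<and> (AE x in ?M. (\<lambda>n. (norm (f (r n) x - u x))\<^sup>2) \<longlonglongrightarrow> 0)"
  proof (rule tendsto_L1_AE_subseq)
    show "integrable ?M (\<lambda>x. (norm (f k x - u x))\<^sup>2)" for k
      using L2_diff[OF ft(1)[of k] u'(1)] by (simp add: L2_def)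
    show "(\<lambda>n. \<integral>x. norm ((norm (f n x - u x))\<^sup>2) \<partial>?M) \<longlonglongrightarrow> 0"
      using tendsto_power[OF f(2), of 2] by (simp add: L2_norm_square)
  qed
  then obtain r where r: "strict_mono r" and ae: "AE x in ?M. (\<lambda>n. (norm (f (r n) x - u x))\<^sup>2) \<longlonglongrightarrow> 0"
    by blast
  note [measurable] = test_function_measurable[OF w, where S=unit_disk] test_function_measurable[OF v, where S=unit_disk] L2_measurable[OF u'(1)]
  have [measurable]: "wt \<in> borel_measurable ?M"
    unfolding wt_def by (intro borel_measurable_lebesgue_onI) simp
  define F where "F x = ennreal ((exp (8 * pi * (u x - v x)\<^sup>2) - 1) * wt x)" for x
  define Fn where "Fn n x = ennreal ((exp (8 * pi * (w (r n) x)\<^sup>2) - 1) * wt x)" for n x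
  have lim: "AE x in ?M. F x = liminf (\<lambda>n. Fn n x)"
    using ae
  proof eventually_elim
    case (elim x)
    have "(\<lambda>n. sqrt ((norm (f (r n) x - u x))\<^sup>2)) \<longlonglongrightarrow> sqrt 0"
      by (intro tendsto_real_sqrt elim)
    then have "(\<lambda>n. f (r n) x - u x) \<longlonglongrightarrow> 0" by (simp add: tendsto_rabs_zero_iff)
    then have "(\<lambda>n. f (r n) x) \<longlonglongrightarrow> u x" by (rule LIM_zero_cancel)
    then have "(\<lambda>n. Fn n x) \<longlonglongrightarrow> F x"
      unfolding Fn_def F_def w_def by (intro tendsto_intros)
    from lim_imp_Liminf[OF trivial_limit_sequentially this] show ?case by simp
  qed
  have "(\<integral>\<^sup>+x. F x \<partial>?M) = (\<integral>\<^sup>+x. liminf (\<lambda>n. Fn n x) \<partial>?M)"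
    by (rule nn_integral_cong_AE[OF lim])
  also have "\<dots> \<le> liminf (\<lambda>n. \<integral>\<^sup>+x. Fn n x \<partial>?M)"
    by (rule nn_integral_liminf) (simp add: Fn_def)
  also have "\<dots> \<le> ennreal C"
  proof (rule Liminf_le)
    show "\<forall>\<^sub>F n in sequentially. (\<integral>\<^sup>+x. Fn n x \<partial>?M) \<le> ennreal C"
      using eventually_ge_at_top[of K]
    proof eventually_elim
      case (elim n)
      then have "r n \<ge> K" using seq_suble[OF r, of n] by linarith
      have "(\<integral>\<^sup>+x. Fn n x \<partial>?M) \<le> (\<integral>\<^sup>+x. ennreal (exp (8 * pi * (w (r n) x)\<^sup>2) - 1) \<partial>hyp)"
        using nn_integral_weight_le_hyp[of "\<lambda>x. exp (8 * pi * (w (r n) x)\<^sup>2) - 1"]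
          C1_supp_measurable(1)[OF test_function_C1_supp[OF w[of "r n"]]]
        by (simp add: Fn_def wt_def)
      then show ?case using w_bound[OF \<open>r n \<ge> K\<close>] by (rule order_trans)
    qed
  qed simp
  finally have intF: "(\<integral>\<^sup>+x. F x \<partial>?M) \<le> ennreal C" .
  note vC = test_function_C1_supp[OF v]
  obtain B where B: "\<And>x. \<bar>v x\<bar> \<le> B"
  proof -
    obtain K' where "compact K'" "\<And>x. x \<notin> K' \<Longrightarrow> v x = 0" using vC by (auto simp: C1_supp_def)
    then show thesis
      using bounded_compact_support[OF C1_supp_continuous(1)[OF vC]] that by (metis real_norm_def)
  qed
  define c where "c = exp (8 * pi * B\<^sup>2)"
  have c: "c \<ge> 0" by (simp add: c_def)
  have "J u \<le> (\<integral>\<^sup>+x. ennreal c * F x + ennreal (8 * pi * c) * ennreal ((v x)\<^sup>2 * wt x) \<partial>?M)"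
    unfolding J_def
  proof (intro nn_integral_mono)
    fix x
    have "(exp (4 * pi * (u x)\<^sup>2) - 1) * wt x \<le> (c * (exp (8 * pi * (u x - v x)\<^sup>2) - 1) + 8 * pi * c * (v x)\<^sup>2) * wt x"
      unfolding c_def by (intro mult_right_mono exp_sum_split B wt0)
    also have "\<dots> = c * ((exp (8 * pi * (u x - v x)\<^sup>2) - 1) * wt x) + (8 * pi * c) * ((v x)\<^sup>2 * wt x)"
      by (simp add: algebra_simps)
    finally have "ennreal ((exp (4 * pi * (u x)\<^sup>2) - 1) * wt x) \<le>
        ennreal (c * ((exp (8 * pi * (u x - v x)\<^sup>2) - 1) * wt x) + (8 * pi * c) * ((v x)\<^sup>2 * wt x))"
      by (rule ennreal_leI)
    also have "\<dots> = ennreal c * F x + ennreal (8 * pi * c) * ennreal ((v x)\<^sup>2 * wt x)"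
      unfolding F_def using c wt0[of x] by (simp add: ennreal_plus ennreal_mult')
    finally show "ennreal ((exp (4 * pi * (u x)\<^sup>2) - 1) / (1 - (norm x)\<^sup>2)\<^sup>2) \<le>
        ennreal c * F x + ennreal (8 * pi * c) * ennreal ((v x)\<^sup>2 * wt x)"
      by (simp add: wt_def)
  qed
  also have "\<dots> = ennreal c * (\<integral>\<^sup>+x. F x \<partial>?M) + ennreal (8 * pi * c) * (\<integral>\<^sup>+x. ennreal ((v x)\<^sup>2 * wt x) \<partial>?M)"
    unfolding F_def by (simp add: nn_integral_add nn_integral_cmult)
  also have "\<dots> < \<infinity>"
  proof -
    have "(\<integral>\<^sup>+x. F x \<partial>?M) < \<infinity>" using intF by (simp add: le_less_trans)
    \<comment> \<open>The quadratic remainder from the test function is finite by Hardy, however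
      large its energy.\<close>
    moreover have "(\<integral>\<^sup>+x. ennreal ((v x)\<^sup>2 * wt x) \<partial>?M) < \<infinity>"
    proof -
      have "(\<integral>\<^sup>+x. ennreal ((v x)\<^sup>2 * wt x) \<partial>?M) \<le> (\<integral>\<^sup>+x. ennreal ((v x)\<^sup>2) \<partial>hyp)"
        using nn_integral_weight_le_hyp[of "\<lambda>x. (v x)\<^sup>2"] C1_supp_measurable(1)[OF vC]
        by (simp add: wt_def)
      also have "\<dots> \<le> (\<integral>\<^sup>+x. ennreal ((norm (grad v x))\<^sup>2) \<partial>lborel)"
        using hardy vC by (simp add: unit_disk_def)
      also have "\<dots> < \<infinity>" by (simp add: test_function_energy[OF unit_disk_open(1) v])
      finally show ?thesis .
    qed
    ultimately show ?thesis by (simp add: ennreal_mult_less_top)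
  qed
  finally show ?thesis .
qed

text \<open>Bessel's inequality without a representation theorem: \<open>L\<close> is tested on the
  sum of L(v k) v k over k < n. With q the sum of the squares of the L(v k), linearity gives the
  value q, and disjointness bounds the squared norm by E q; so q \<le> C sqrt(E q), hence q \<le>
  C^2 E for all n, and the terms of a summable series tend to 0.\<close>

lemma H01_dual_disjoint_tendsto_0:
  assumes U: "bounded U" "open U" and v: "\<And>k. v k \<in> test_functions U"
    and disj: "\<And>j k x. j \<noteq> k \<Longrightarrow> grad (v j) x = 0 \<or> grad (v k) x = 0"
    and E: "\<And>k. (L2_norm U (grad (v k)))\<^sup>2 \<le> E"
    and L: "L \<in> H01_dual U"
  shows "(\<lambda>k. L (v k)) \<longlonglongrightarrow> 0"
proof -
  have vH: "\<phi> \<in> H01 U" if "\<phi> \<in> test_functions U" for \<phi> using H01_test_function[OF U that] by simp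
  have add: "L (\<lambda>x. f x + g x) = L f + L g" if "f \<in> H01 U" "g \<in> H01 U" for f g
    using L that by (auto simp: H01_dual_def)
  have cmult: "L (\<lambda>x. c * f x) = c * L f" if "f \<in> H01 U" for c f
    using L that by (auto simp: H01_dual_def)
  have "\<exists>C. \<forall>f\<in>H01 U. \<bar>L f\<bar> \<le> C * H01_norm U f"
    using L by (simp add: H01_dual_def)
  then obtain C where C: "\<And>f. f \<in> H01 U \<Longrightarrow> \<bar>L f\<bar> \<le> C * H01_norm U f" by blast
  define c where "c k = L (v k)" for k
  define S where "S n x = (\<Sum>k<n. c k * v k x)" for n x
  have S: "S n \<in> test_functions U" for n
    unfolding S_def[abs_def] by (intro test_functions_sum test_functions_cmult v) auto
  have LS: "L (S n) = (\<Sum>k<n. (c k)\<^sup>2)" for n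
  proof (induction n)
    case 0
    \<comment> \<open>That \<open>L\<close> vanishes at the zero function comes from homogeneity
      with factor 0.\<close>
    have "L (\<lambda>x. 0 * v 0 x) = 0 * L (v 0)" by (rule cmult[OF vH[OF v]])
    then show ?case by (simp add: S_def[abs_def])
  next
    case (Suc n)
    have "L (S (Suc n)) = L (\<lambda>x. S n x + c n * v n x)" by (simp add: S_def[abs_def])
    also have "\<dots> = L (S n) + c n * c n"
      using add[OF vH[OF S] vH[OF test_functions_cmult[OF v]]] cmult[OF vH[OF v]] by (simp add: c_def)
    finally show ?case using Suc by (simp add: power2_eq_square)
  qed
  have int: "integrable (lebesgue_on U) (\<lambda>x. (norm (grad (v k) x))\<^sup>2)" for k
    using test_function_L2(2)[OF U(2) v] by (simp add: L2_def)
  have pyth: "(norm (\<Sum>k<n. c k *\<^sub>R grad (v k) x))\<^sup>2 = (\<Sum>k<n. (c k)\<^sup>2 * (norm (grad (v k) x))\<^sup>2)" for n x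
  proof (induction n)
    case (Suc n)
    have "(\<Sum>k<n. c k *\<^sub>R grad (v k) x) \<bullet> (c n *\<^sub>R grad (v n) x) = 0"
      unfolding inner_sum_left using disj by (intro sum.neutral) (metis inner_eq_zero_iff inner_scaleR_left inner_scaleR_right inner_zero_left inner_zero_right lessThan_iff less_irrefl mult_zero_right)
    then have "(norm ((\<Sum>k<n. c k *\<^sub>R grad (v k) x) + c n *\<^sub>R grad (v n) x))\<^sup>2 =
        (norm (\<Sum>k<n. c k *\<^sub>R grad (v k) x))\<^sup>2 + (norm (c n *\<^sub>R grad (v n) x))\<^sup>2"
      by (intro norm_add_Pythagorean) (simp only: orthogonal_def)
    then show ?case using Suc by (simp add: power_mult_distrib)
  qed simp
  have normS: "(L2_norm U (grad (S n)))\<^sup>2 \<le> E * (\<Sum>k<n. (c k)\<^sup>2)" for n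
  proof -
    have "grad (S n) x = (\<Sum>k<n. c k *\<^sub>R grad (v k) x)" for x
      unfolding S_def[abs_def]
      by (simp add: test_function_grad_sum[of _ "\<lambda>k x. c k * v k x", OF _ test_functions_cmult[OF v]] test_function_grad_cmult[OF v])
    then have "(L2_norm U (grad (S n)))\<^sup>2 = (\<Sum>k<n. (c k)\<^sup>2 * (L2_norm U (grad (v k)))\<^sup>2)"
      using int by (simp add: L2_norm_square pyth)
    also have "\<dots> \<le> (\<Sum>k<n. (c k)\<^sup>2 * E)" by (intro sum_mono mult_left_mono E) auto
    finally show ?thesis by (simp add: sum_distrib_left mult.commute)
  qed
  have bound: "(\<Sum>k<n. (c k)\<^sup>2) \<le> C\<^sup>2 * E" for n
  proof -
    define q where "q = (\<Sum>k<n. (c k)\<^sup>2)"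
    have q: "q \<ge> 0" unfolding q_def by (intro sum_nonneg) auto
    have "q \<le> C * L2_norm U (grad (S n))"
      using C[OF vH[OF S[of n]]] LS[of n] q H01_test_function(2)[OF U S[of n]] by (simp add: q_def)
    then have "q\<^sup>2 \<le> (C * L2_norm U (grad (S n)))\<^sup>2" using q by (intro power_mono)
    also have "\<dots> \<le> C\<^sup>2 * (E * q)"
      using normS[of n] by (simp add: power_mult_distrib q_def mult_left_mono)
    finally have "q * q \<le> (C\<^sup>2 * E) * q" by (simp add: power2_eq_square mult_ac)
    moreover have "0 \<le> E" using E[of 0] zero_le_power2 order_trans by blast
    ultimately show ?thesis unfolding q_def[symmetric] using q by (cases "q = 0") auto
  qed
  have "summable (\<lambda>k. (c k)\<^sup>2)"
    by (rule bounded_imp_summable[where B="C\<^sup>2 * E"]) (use bound[of "Suc _"] in \<open>auto simp: lessThan_Suc_atMost\<close>)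
  then have "(\<lambda>k. sqrt ((c k)\<^sup>2)) \<longlonglongrightarrow> sqrt 0"
    by (intro tendsto_real_sqrt summable_LIMSEQ_zero)
  then show ?thesis by (simp add: c_def tendsto_rabs_zero_iff)
qed

section \<open>Energy and size of bumps near the boundary\<close>

lemma flat_2_le: "\<bar>flat 2 s\<bar> \<le> 2"
proof (cases "s > 0")
  case True
  \<comment> \<open>\<open>flat 2\<close> is the derivative of \<open>flat 0\<close>; the quadratic
    term of the exponential series at 1/s bounds this slope.\<close>
  have "(1 / s)\<^sup>2 / 2 \<le> exp (1 / s)"
    using exp_lower_Taylor_quadratic[of "1 / s"] True by (simp add: power2_eq_square) (smt (verit) divide_pos_pos)
  then show ?thesis using True by (simp add: flat_def exp_minus field_simps)
qed (simp add: flat_def)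

lemma grad_bump_le:
  assumes "r > 0"
  shows "norm (grad (bump a r) x) \<le> 4 / r" "x \<notin> ball a r \<Longrightarrow> grad (bump a r) x = 0"
proof -
  define s where "s = 1 - (1 / r\<^sup>2) * ((x - a) \<bullet> (x - a))"
  from GDERIV_DERIV_compose[OF GDERIV_quadratic[of 1 "1 / r\<^sup>2" a x] flat_deriv[of 0]]
  have "GDERIV (bump a r) x :> flat 2 s *\<^sub>R ((- 2 / r\<^sup>2) *\<^sub>R (x - a))"
    by (simp add: bump_def[abs_def] s_def numeral_2_eq_2)
  then have G: "grad (bump a r) x = flat 2 s *\<^sub>R ((- 2 / r\<^sup>2) *\<^sub>R (x - a))"
    by (rule grad_eqI)
  show zero: "grad (bump a r) x = 0" if "x \<notin> ball a r"
  proof -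
    have "bump a r x = 0" using bump_nonzero_iff[OF assms, of a x] that by blast
    then have "flat 0 s = 0" by (simp add: bump_def s_def)
    then have "flat 2 s = 0" by (auto simp: flat_def split: if_splits)
    then show ?thesis using G by simp
  qed
  show "norm (grad (bump a r) x) \<le> 4 / r"
  proof (cases "x \<in> ball a r")
    case True
    then have "norm (x - a) \<le> r" by (simp add: dist_norm norm_minus_commute)
    then have "\<bar>flat 2 s\<bar> * (2 / r\<^sup>2 * norm (x - a)) \<le> 2 * (2 / r\<^sup>2 * r)"
      using flat_2_le assms by (intro mult_mono) auto
    then show ?thesis using assms G by (simp add: abs_mult power2_eq_square)
  qed (use zero assms in simp)
qed

text \<open>Scale invariance of the Dirichlet integral in the plane: (4/r)^2 times the area of the
  disk, pi r^2.\<close>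

lemma bump_energy:
  fixes a :: "real^2"
  assumes "open U" "r > 0" "cball a r \<subseteq> U"
  shows "(L2_norm U (grad (bump a r)))\<^sup>2 \<le> 16 * pi"
proof -
  have "ennreal ((L2_norm U (grad (bump a r)))\<^sup>2) = (\<integral>\<^sup>+x. ennreal ((norm (grad (bump a r) x))\<^sup>2) \<partial>lborel)"
    using test_function_energy[OF assms(1) bump_test_function[OF assms(2,3)]] by simp
  also have "\<dots> \<le> (\<integral>\<^sup>+x. ennreal ((4 / r)\<^sup>2) * indicator (ball a r) x \<partial>lborel)"
    using grad_bump_le[OF assms(2)]
    by (intro nn_integral_mono) (auto simp: indicator_def intro!: ennreal_leI power_mono simp del: mem_ball)
  also have "\<dots> = ennreal ((4 / r)\<^sup>2) * ennreal (pi * r\<^sup>2)"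
    using assms(2) by (simp add: nn_integral_cmult_indicator emeasure_ball unit_ball_vol_2)
  also have "\<dots> = ennreal (16 * pi)"
    using assms(2) by (simp add: power_divide flip: ennreal_mult)
  finally show ?thesis by (simp add: ennreal_le_iff)
qed

text \<open>On the half-size disk the profile has argument at least 3/4, so the bump is at least
  exp(-4/3). There 1 - |x| \<le> 5 r and hence 1 - |x|^2 \<le> 10 r, so the weight is at least 1 /
  (100 r^2). Together with exp y - 1 \<ge> y and the area pi r^2 / 4, the radius cancels.\<close>

lemma J_bump_ge:
  fixes a :: "real^2"
  assumes r: "r > 0" and a: "norm a = 1 - 4 * r" "4 * r \<le> 1"
  shows "ennreal (t\<^sup>2 * (pi\<^sup>2 * exp (- 8 / 3) / 100)) \<le> J (\<lambda>x. t * bump a r x)"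
proof -
  define A where "A = 4 * pi * t\<^sup>2 * exp (- 8 / 3) / (10 * r)\<^sup>2"
  have sub: "ball a (r / 2) \<subseteq> unit_disk"
  proof
    fix x assume "x \<in> ball a (r / 2)"
    then have "norm (x - a) < r / 2" by (simp add: dist_norm norm_minus_commute)
    then show "x \<in> unit_disk"
      using norm_triangle_sub[of x a] a r by (simp add: unit_disk_def)
  qed
  have "ennreal (t\<^sup>2 * (pi\<^sup>2 * exp (- 8 / 3) / 100)) = ennreal A * ennreal (pi * (r / 2)\<^sup>2)"
  proof -
    have "t\<^sup>2 * (pi\<^sup>2 * exp (- 8 / 3) / 100) = A * (pi * (r / 2)\<^sup>2)"
      using r by (simp add: A_def power2_eq_square)
    moreover have "A \<ge> 0" by (simp add: A_def)
    ultimately show ?thesis by (simp only: ennreal_mult zero_le_mult_iff pi_ge_zero zero_le_power2 simp_thms)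
  qed
  also have "\<dots> = (\<integral>\<^sup>+x. ennreal A * indicator (ball a (r / 2)) x \<partial>lborel)"
    using r by (simp add: nn_integral_cmult_indicator emeasure_ball unit_ball_vol_2)
  also have "\<dots> = (\<integral>\<^sup>+x. ennreal A * indicator (ball a (r / 2)) x * indicator unit_disk x \<partial>lborel)"
    using sub by (intro nn_integral_cong) (auto simp: indicator_def)
  also have "\<dots> = (\<integral>\<^sup>+x. ennreal A * indicator (ball a (r / 2)) x \<partial>lebesgue_on unit_disk)"
    by (simp add: nn_integral_restrict_space unit_disk_def nn_integral_completion)
  also have "\<dots> \<le> J (\<lambda>x. t * bump a r x)"
    unfolding J_def
  proof (intro nn_integral_mono)
    fix x
    show "ennreal A * indicator (ball a (r / 2)) x \<le>
        ennreal ((exp (4 * pi * (t * bump a r x)\<^sup>2) - 1) / (1 - (norm x)\<^sup>2)\<^sup>2)"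
    proof (cases "x \<in> ball a (r / 2)")
      case True
      then have n: "norm (x - a) < r / 2" by (simp add: dist_norm norm_minus_commute)
      have "(norm (x - a))\<^sup>2 \<le> (r / 2)\<^sup>2" using n by (intro power_mono) auto
      then have "3 / 4 \<le> 1 - (1 / r\<^sup>2) * ((x - a) \<bullet> (x - a))" (is "_ \<le> ?s")
        using r by (simp add: power2_norm_eq_inner field_simps)
      then have "exp (- (4 / 3)) \<le> flat 0 ?s"
        unfolding flat_def by (simp add: field_simps)
      then have "exp (- (4 / 3)) \<le> bump a r x" by (simp add: bump_def)
      then have "(exp (- (4 / 3)))\<^sup>2 \<le> (bump a r x)\<^sup>2" by (rule power_mono) simp
      then have b: "exp (- 8 / 3) \<le> (bump a r x)\<^sup>2" by (simp add: power2_eq_square flip: exp_add)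
      have "4 * pi * t\<^sup>2 * exp (- 8 / 3) \<le> 4 * pi * t\<^sup>2 * (bump a r x)\<^sup>2"
        by (rule mult_left_mono[OF b]) simp
      also have "\<dots> = 4 * pi * (t * bump a r x)\<^sup>2" by (simp add: power_mult_distrib)
      also have "\<dots> \<le> exp (4 * pi * (t * bump a r x)\<^sup>2) - 1"
        using exp_ge_add_one_self[of "4 * pi * (t * bump a r x)\<^sup>2"] by linarith
      finally have num: "4 * pi * t\<^sup>2 * exp (- 8 / 3) \<le> exp (4 * pi * (t * bump a r x)\<^sup>2) - 1" .
      have x1: "norm x < 1" using True sub by (auto simp: unit_disk_def)
      have "norm a \<le> norm x + norm (x - a)" using norm_triangle_sub[of a x] by (simp add: norm_minus_commute)
      then have "1 - norm x \<le> 5 * r" using n a r by simp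
      then have "(1 - norm x) * (1 + norm x) \<le> (5 * r) * 2" using x1 r by (intro mult_mono) auto
      then have le: "1 - (norm x)\<^sup>2 \<le> 10 * r" by (simp add: algebra_simps power2_eq_square)
      have "(norm x)\<^sup>2 < 1" using x1 by (simp add: abs_square_less_1)
      then have den: "0 < (1 - (norm x)\<^sup>2)\<^sup>2" "(1 - (norm x)\<^sup>2)\<^sup>2 \<le> (10 * r)\<^sup>2"
        using power_mono[OF le, of 2] by auto
      have "A \<le> (exp (4 * pi * (t * bump a r x)\<^sup>2) - 1) / (1 - (norm x)\<^sup>2)\<^sup>2"
        unfolding A_def using num den by (intro frac_le) auto
      then show ?thesis using True by (simp add: ennreal_leI)
    qed simp
  qed
  finally show ?thesis .
qed

text \<open>With p and q the square roots of the two exponentials, p^2 + q^2 \<ge> 2 p q, and the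
  parallelogram law makes p q = exp(4 pi (u^2 + v^2)) \<ge> exp(4 pi v^2).\<close>

lemma J_parallelogram:
  assumes u: "u \<in> borel_measurable (lebesgue_on unit_disk)" and v: "v \<in> borel_measurable (lebesgue_on unit_disk)"
  shows "J v + J v \<le> J (\<lambda>x. u x + v x) + J (\<lambda>x. u x - v x)"
proof -
  let ?M = "lebesgue_on unit_disk"
  note [measurable] = u v
  have [measurable]: "(\<lambda>x. (1 - (norm x)\<^sup>2)\<^sup>2) \<in> borel_measurable ?M"
    by (intro borel_measurable_lebesgue_onI) simp
  have "J v + J v = (\<integral>\<^sup>+x. ennreal ((exp (4 * pi * (v x)\<^sup>2) - 1) / (1 - (norm x)\<^sup>2)\<^sup>2)
     + ennreal ((exp (4 * pi * (v x)\<^sup>2) - 1) / (1 - (norm x)\<^sup>2)\<^sup>2) \<partial>?M)"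
    unfolding J_def by (subst nn_integral_add) auto
  also have "\<dots> \<le> (\<integral>\<^sup>+x. ennreal ((exp (4 * pi * (u x + v x)\<^sup>2) - 1) / (1 - (norm x)\<^sup>2)\<^sup>2)
     + ennreal ((exp (4 * pi * (u x - v x)\<^sup>2) - 1) / (1 - (norm x)\<^sup>2)\<^sup>2) \<partial>?M)"
  proof (intro nn_integral_mono)
    fix x
    define p where "p = exp (2 * pi * (u x + v x)\<^sup>2)"
    define q where "q = exp (2 * pi * (u x - v x)\<^sup>2)"
    have p2: "p\<^sup>2 = exp (4 * pi * (u x + v x)\<^sup>2)" and q2: "q\<^sup>2 = exp (4 * pi * (u x - v x)\<^sup>2)"
      by (simp_all add: p_def q_def power2_eq_square[of "exp _"] flip: exp_add)
    have "exp (4 * pi * (v x)\<^sup>2) \<le> exp (4 * pi * (u x)\<^sup>2 + 4 * pi * (v x)\<^sup>2)" by simp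
    also have "\<dots> = p * q"
      by (simp add: p_def q_def power2_sum power2_diff algebra_simps flip: exp_add)
    finally have "2 * exp (4 * pi * (v x)\<^sup>2) \<le> 2 * p * q" by simp
    also have "\<dots> \<le> p\<^sup>2 + q\<^sup>2" by (rule sum_squares_bound)
    finally have "((exp (4 * pi * (v x)\<^sup>2) - 1) + (exp (4 * pi * (v x)\<^sup>2) - 1)) / (1 - (norm x)\<^sup>2)\<^sup>2 \<le>
        ((exp (4 * pi * (u x + v x)\<^sup>2) - 1) + (exp (4 * pi * (u x - v x)\<^sup>2) - 1)) / (1 - (norm x)\<^sup>2)\<^sup>2"
      unfolding p2 q2 by (intro divide_right_mono) auto
    then have "ennreal ((exp (4 * pi * (v x)\<^sup>2) - 1) / (1 - (norm x)\<^sup>2)\<^sup>2 + (exp (4 * pi * (v x)\<^sup>2) - 1) / (1 - (norm x)\<^sup>2)\<^sup>2) \<le>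
        ennreal ((exp (4 * pi * (u x + v x)\<^sup>2) - 1) / (1 - (norm x)\<^sup>2)\<^sup>2 + (exp (4 * pi * (u x - v x)\<^sup>2) - 1) / (1 - (norm x)\<^sup>2)\<^sup>2)"
      by (intro ennreal_leI) (simp only: add_divide_distrib)
    then show "ennreal ((exp (4 * pi * (v x)\<^sup>2) - 1) / (1 - (norm x)\<^sup>2)\<^sup>2)
     + ennreal ((exp (4 * pi * (v x)\<^sup>2) - 1) / (1 - (norm x)\<^sup>2)\<^sup>2) \<le>
       ennreal ((exp (4 * pi * (u x + v x)\<^sup>2) - 1) / (1 - (norm x)\<^sup>2)\<^sup>2)
     + ennreal ((exp (4 * pi * (u x - v x)\<^sup>2) - 1) / (1 - (norm x)\<^sup>2)\<^sup>2)"
      by (subst (asm) (1 2) ennreal_plus) auto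
  qed
  also have "\<dots> = J (\<lambda>x. u x + v x) + J (\<lambda>x. u x - v x)"
    unfolding J_def by (intro nn_integral_add) auto
  finally show ?thesis .
qed

text \<open>The bumps march along a radius towards the unit circle. The energy bound
  \<open>E\<close> depends on \<open>N\<close> through the amplitude but is the same for all
  bumps.\<close>

lemma boundary_bumps:
  fixes N :: real
  shows "\<exists>(v :: nat \<Rightarrow> real^2 \<Rightarrow> real) E. (\<forall>k. v k \<in> test_functions unit_disk) \<and>
    (\<forall>j k x. j \<noteq> k \<longrightarrow> grad (v j) x = 0 \<or> grad (v k) x = 0) \<and>
    (\<forall>k. (L2_norm unit_disk (grad (v k)))\<^sup>2 \<le> E) \<and> (\<forall>k. ennreal N \<le> J (v k))"
proof -
  define c where "c = pi\<^sup>2 * exp (- 8 / 3) / 100"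
  have c: "c > 0" by (simp add: c_def)
  \<comment> \<open>The amplitude at which \<open>J_bump_ge\<close> yields \<open>N\<close>;
    \<open>max\<close> keeps the root meaningful for negative \<open>N\<close>.\<close>
  define t where "t = sqrt (max N 0 / c)"
  have t: "t\<^sup>2 * c = max N 0" using c by (simp add: t_def)
  define e :: "real^2" where "e = axis 1 1"
  have e: "norm e = 1" by (simp add: e_def)
  \<comment> \<open>Disk k lies in the strip between 1 - 5 r k and 1 - 3 r k along \<open>e\<close>.
    As the radii halve, 5 r (k + 1) = 5/2 r k < 3 r k, so the strips are disjoint.\<close>
  define r :: "nat \<Rightarrow> real" where "r k = (1 / 2) ^ k / 8" for k
  have r: "r k > 0" "4 * r k \<le> 1" for k
  proof -
    show "r k > 0" by (simp add: r_def)
    have "(1 / 2 :: real) ^ k \<le> 1" by (intro power_le_one) auto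
    then show "4 * r k \<le> 1" by (simp add: r_def)
  qed
  define a where "a k = (1 - 4 * r k) *\<^sub>R e" for k
  have a: "norm (a k) = 1 - 4 * r k" for k using r[of k] by (simp add: a_def e)
  have sub: "cball (a k) (r k) \<subseteq> unit_disk" for k
  proof
    fix x assume "x \<in> cball (a k) (r k)"
    then have "norm (x - a k) \<le> r k" by (simp add: dist_norm norm_minus_commute)
    then show "x \<in> unit_disk"
      using norm_triangle_sub[of x "a k"] a[of k] r[of k] by (simp add: unit_disk_def)
  qed
  have near: "\<bar>x \<bullet> e - (1 - 4 * r k)\<bar> < r k" if "x \<in> ball (a k) (r k)" for x k
  proof -
    have "\<bar>(x - a k) \<bullet> e\<bar> \<le> norm (x - a k)" using Cauchy_Schwarz_ineq2[of "x - a k" e] e by simp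
    also have "\<dots> < r k" using that by (simp add: dist_norm norm_minus_commute)
    finally show ?thesis using e by (simp add: a_def inner_diff_left flip: power2_norm_eq_inner)
  qed
  have less: "x \<notin> ball (a j) (r j) \<or> x \<notin> ball (a k) (r k)" if "j < k" for j k x
  proof (rule ccontr)
    assume "\<not> ?thesis"
    then have "\<bar>x \<bullet> e - (1 - 4 * r j)\<bar> < r j" "\<bar>x \<bullet> e - (1 - 4 * r k)\<bar> < r k"
      using near by blast+
    moreover have "r k \<le> r (Suc j)"
      unfolding r_def using that by (intro divide_right_mono power_decreasing) auto
    then have "2 * r k \<le> r j" by (simp add: r_def)
    ultimately show False using r(1)[of j] by linarith
  qed
  have disj: "grad (bump (a j) (r j)) x = 0 \<or> grad (bump (a k) (r k)) x = 0" if "j \<noteq> k" for j k x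
    using less[of j k x] less[of k j x] that grad_bump_le(2)[OF r(1)] nat_neq_iff by metis
  note b = bump_test_function[OF r(1) sub]
  show ?thesis
  proof (intro exI[of _ "\<lambda>k x. t * bump (a k) (r k) x"] exI[of _ "t\<^sup>2 * (16 * pi)"] conjI allI impI)
    show "(\<lambda>x. t * bump (a k) (r k) x) \<in> test_functions unit_disk" for k
      by (intro test_functions_cmult b)
    show "grad (\<lambda>x. t * bump (a j) (r j) x) x = 0 \<or> grad (\<lambda>x. t * bump (a k) (r k) x) x = 0"
      if "j \<noteq> k" for j k x
      using disj[OF that, of x] by (auto simp: test_function_grad_cmult[OF b])
    show "(L2_norm unit_disk (grad (\<lambda>x. t * bump (a k) (r k) x)))\<^sup>2 \<le> t\<^sup>2 * (16 * pi)" for k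
    proof -
      have "(L2_norm unit_disk (grad (\<lambda>x. t * bump (a k) (r k) x)))\<^sup>2 = t\<^sup>2 * (L2_norm unit_disk (grad (bump (a k) (r k))))\<^sup>2"
        by (simp add: L2_norm_square test_function_grad_cmult[OF b] power_mult_distrib)
      then show ?thesis
        using bump_energy[OF unit_disk_open(1) r(1) sub] by (simp add: mult_left_mono)
    qed
    show "ennreal N \<le> J (\<lambda>x. t * bump (a k) (r k) x)" for k
    proof -
      have "ennreal N \<le> ennreal (t\<^sup>2 * c)" unfolding t by (intro ennreal_leI) simp
      also have "\<dots> \<le> J (\<lambda>x. t * bump (a k) (r k) x)"
        unfolding c_def by (rule J_bump_ge[OF r(1) a r(2)])
      finally show ?thesis .
    qed
  qed
qed

theorem proposition3:
  fixes u :: "real^2 \<Rightarrow> real"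
  assumes "u \<in> H01 unit_disk"
  shows "\<exists>us :: nat \<Rightarrow> real^2 \<Rightarrow> real.
           (\<forall>k. us k \<in> H01 unit_disk) \<and>
           weakly_converges_H01 unit_disk us u \<and>
           \<not> (\<lambda>k. J (us k)) \<longlonglongrightarrow> J u"
proof -
  obtain j where j: "J u = ennreal j" "0 \<le> j"
    using J_finite[OF assms] by (metis ennreal_cases infinity_ennreal_def less_irrefl)
  \<comment> \<open>The surplus 1 over \<open>J u\<close> survives the passage to the limit.\<close>
  from boundary_bumps[of "j + 1"] obtain v :: "nat \<Rightarrow> real^2 \<Rightarrow> real" and E
    where v': "\<forall>k. v k \<in> test_functions unit_disk"
    "\<forall>j k x. j \<noteq> k \<longrightarrow> grad (v j) x = 0 \<or> grad (v k) x = 0"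
    "\<forall>k. (L2_norm unit_disk (grad (v k)))\<^sup>2 \<le> E"
    "\<forall>k. ennreal (j + 1) \<le> J (v k)"
    by blast
  note v = v'[rule_format]
  have um: "u \<in> borel_measurable (lebesgue_on unit_disk)"
    using assms by (intro L2_measurable H1_weak_grad(1)) (simp add: H01_def)
  define us where "us \<sigma> k x = u x + \<sigma> * v k x" for \<sigma> :: real and k x
  have t: "(\<lambda>x. \<sigma> * v k x) \<in> test_functions unit_disk" for \<sigma> k
    by (rule test_functions_cmult[OF v(1)])
  have H: "us \<sigma> k \<in> H01 unit_disk" for \<sigma> k
    unfolding us_def[abs_def] by (rule H01_add_test_function[OF unit_disk_open(2,1) assms t])
  have weak: "weakly_converges_H01 unit_disk (us \<sigma>) u" for \<sigma>
    unfolding weakly_converges_H01_def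
  proof
    fix L assume L: "L \<in> H01_dual unit_disk"
    have v0: "(\<lambda>k. L (v k)) \<longlonglongrightarrow> 0"
      by (rule H01_dual_disjoint_tendsto_0[OF unit_disk_open(2,1) v(1,2,3) L])
    have "L (us \<sigma> k) = L u + \<sigma> * L (v k)" for k
      using L assms H01_test_function(1)[OF unit_disk_open(2,1) t[of \<sigma> k]]
        H01_test_function(1)[OF unit_disk_open(2,1) v(1)[of k]]
      unfolding H01_dual_def us_def[abs_def] by simp
    then show "(\<lambda>k. L (us \<sigma> k)) \<longlonglongrightarrow> L u"
      using tendsto_add[OF tendsto_const tendsto_mult[OF tendsto_const v0], of "L u" \<sigma>] by simp
  qed
  \<comment> \<open>It stays open which of the signs 1 and -1 fails; if both succeeded, the limit of
    the sum would give 2 (j + 1) \<le> 2 j.\<close>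
  have "\<exists>\<sigma>. \<not> (\<lambda>k. J (us \<sigma> k)) \<longlonglongrightarrow> J u"
  proof (rule ccontr)
    assume "\<not> ?thesis"
    then have "(\<lambda>k. J (us 1 k) + J (us (-1) k)) \<longlonglongrightarrow> J u + J u"
      by (intro tendsto_add) auto
    moreover have "ennreal (j + 1) + ennreal (j + 1) \<le> J (us 1 k) + J (us (-1) k)" for k
    proof -
      have "ennreal (j + 1) + ennreal (j + 1) \<le> J (v k) + J (v k)"
        by (intro add_mono v)
      also have "\<dots> \<le> J (us 1 k) + J (us (-1) k)"
        using J_parallelogram[OF um test_function_measurable(1)[OF v(1)]]
        by (simp add: us_def[abs_def])
      finally show ?thesis .
    qed
    ultimately have "ennreal (j + 1) + ennreal (j + 1) \<le> J u + J u"
      by (intro LIMSEQ_le_const) auto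
    then show False
      using j by (simp flip: ennreal_plus)
  qed
  then show ?thesis using H weak by blast
qed

end
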